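(* Let $\theta\in[0,1)$ and $\mu_0>\mu_1\ge0$. The segment $\mathrm{CP}[\mu_1,\mu_0]$ of the central path can be decomposed into a sequence of $T$ consecutive $\frac{1-\theta}{4n}$-polarized segments with polarization partitions $(B^{(k)},N^{(k)})$, $k\in[T]$ (that is, there exist $T\in\mathbb N$ and $\mu_0=h_0>h_1>\dots>h_T=\mu_1$ such that $\mathrm{CP}[h_k,h_{k-1}]$ is $\frac{1-\theta}{4n}$-polarized with partition $(B^{(k)},N^{(k)})$ for each $k\in[T]$), such that, with $N^{(0)}:=\emptyset$, $$\max\Big\{\sum_{k=1}^T|N^{(k)}\Delta N^{(k-1)}|,\ T\Big\}\le 2\min\Big\{\sum_{i=1}^n\mathrm{SLC}^{\mathrm p}_{i,\theta}(n\mu_1,n\mu_0),\ \sum_{i=1}^n\mathrm{SLC}^{\mathrm d}_{i,\theta}(n\mu_1,n\mu_0)\Big\}.$$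
   Context: $A\in\mathbb R^{m\times n}$ has rank $m\le n$, $b\in\mathbb R^m$, $c\in\mathbb R^n$. The primal-dual pair is $\min\{\langle c,x\rangle: Ax=b,\ x\ge 0\}$ and $\max\{\langle b,y\rangle: A^\top y+s=c,\ s\ge 0\}$, feasible and bounded with optimal value $v^\star$; both are assumed to have strictly feasible points ($x>0$, resp. $s>0$). Central path: for $\mu>0$, $z^{\mathrm{cp}}(\mu)=(x^{\mathrm{cp}}(\mu),s^{\mathrm{cp}}(\mu))$ is given by the unique solution of $Ax=b$, $x>0$, $A^\top y+s=c$, $s>0$, $x_is_i=\mu$ for all $i\in[n]$; $z^{\mathrm{cp}}(0)$ is the limit as $\mu\searrow0$. $\mathrm{CP}[\mu_1,\mu_0]=\{z^{\mathrm{cp}}(\mu):\mu_1\le\mu\le\mu_0\}$. Polarization: for $\gamma\in(0,1]$ and $\mu_0>\mu_1\ge0$, $\mathrm{CP}[\mu_1,\mu_0]$ is $\gamma$-polarized (with polarization partition $(B,N)$) if $B\cup N=[n]$ is a partition (possibly with an empty part) such that for all $\mu\in[\mu_1,\mu_0]$: $x^{\mathrm{cp}}_i(\mu)\ge\gamma x^{\mathrm{cp}}_i(\mu_0)$ for $i\in B$ and $s^{\mathrm{cp}}_i(\mu)\ge\gamma s^{\mathrm{cp}}_i(\mu_0)$ for $i\in N$. Straight-line complexity: for $g\ge0$, $x^{\mathfrak m}_i(g)=\max\{x_i: Ax=b,x\ge0,\langle c,x\rangle\le v^\star+g\}$ and $s^{\mathfrak m}_i(g)=\max\{s_i: A^\top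 y+s=c,s\ge0,\langle b,y\rangle\ge v^\star-g\}$. Let $\mathcal N^{\mathfrak{mp}}_i(\theta)=\{(g,z)\in\mathbb R^2_+:(1-\theta)x^{\mathfrak m}_i(g)\le z\le x^{\mathfrak m}_i(g)\}$ and let $\mathcal N^{\mathfrak{md}}_i(\theta)$ be defined in the same way with $s^{\mathfrak m}_i$. For $0\le\underline g\le\overline g$, $\mathrm{SLC}^{\mathrm p}_{i,\theta}(\underline g,\overline g)$ is the minimum $p\ge1$ such that there are points $(g_k,z_k)\in\mathbb R^2_+$, $k\in[p+1]$, with $g_1=\overline g$, $g_{p+1}=\underline g$ and every segment $[(g_k,z_k),(g_{k+1},z_{k+1})]$, $k\in[p]$, contained in $\mathcal N^{\mathfrak{mp}}_i(\theta)$; $\mathrm{SLC}^{\mathrm d}_{i,\theta}$ is the same with $\mathcal N^{\mathfrak{md}}_i(\theta)$. $S\Delta T$ denotes symmetric difference. *)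

theory Defs
  imports "HOL-Analysis.Analysis"
begin

text \<open>
  The linear program is given by \<open>A :: real^'n^'m\<close>, \<open>b :: real^'m\<close>, \<open>c :: real^'n\<close>, so the number of
  variables is \<^term>\<open>CARD('n)\<close> and the number of equality constraints is \<^term>\<open>CARD('m)\<close>.
\<close>

definition primal_feasible :: "real^'n^'m \<Rightarrow> real^'m \<Rightarrow> (real^'n) set" where
  "primal_feasible A b = {x. A *v x = b \<and> (\<forall>i. 0 \<le> x $ i)}"

definition dual_feasible :: "real^'n^'m \<Rightarrow> real^'n \<Rightarrow> ((real^'m) \<times> (real^'n)) set" where
  "dual_feasible A c = {(y, s). transpose A *v y + s = c \<and> (\<forall>i. 0 \<le> s $ i)}"

definition primal_strictly_feasible :: "real^'n^'m \<Rightarrow> real^'m \<Rightarrow> bool" where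
  "primal_strictly_feasible A b \<longleftrightarrow> (\<exists>x. A *v x = b \<and> (\<forall>i. 0 < x $ i))"

definition dual_strictly_feasible :: "real^'n^'m \<Rightarrow> real^'n \<Rightarrow> bool" where
  "dual_strictly_feasible A c \<longleftrightarrow> (\<exists>y s. transpose A *v y + s = c \<and> (\<forall>i. 0 < s $ i))"

text \<open>
  The optimal value is taken from the primal program. Under strict feasibility of both programs
  the infimum is a minimum and, by strong duality, equals the optimal value of the dual program.
\<close>

definition opt_value :: "real^'n^'m \<Rightarrow> real^'m \<Rightarrow> real^'n \<Rightarrow> real" where
  "opt_value A b c = (INF x\<in>primal_feasible A b. c \<bullet> x)"

definition is_central_point ::
    "real^'n^'m \<Rightarrow> real^'m \<Rightarrow> real^'n \<Rightarrow> real \<Rightarrow> (real^'n) \<times> (real^'n) \<Rightarrow> bool" where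
  "is_central_point A b c \<mu> = (\<lambda>(x, s).
     A *v x = b \<and> (\<forall>i. 0 < x $ i) \<and>
     (\<exists>y. transpose A *v y + s = c) \<and> (\<forall>i. 0 < s $ i) \<and>
     (\<forall>i. x $ i * s $ i = \<mu>))"

text \<open>Only used for \<^term>\<open>\<mu> \<ge> 0\<close>; the value at \<^term>\<open>0\<close> is the limit point of the path.\<close>

definition central_path ::
    "real^'n^'m \<Rightarrow> real^'m \<Rightarrow> real^'n \<Rightarrow> real \<Rightarrow> (real^'n) \<times> (real^'n)" where
  "central_path A b c \<mu> =
     (if 0 < \<mu> then (THE z. is_central_point A b c \<mu> z)
      else Lim (at_right 0) (\<lambda>\<nu>. THE z. is_central_point A b c \<nu> z))"

abbreviation x_cp :: "real^'n^'m \<Rightarrow> real^'m \<Rightarrow> real^'n \<Rightarrow> real \<Rightarrow> real^'n" where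
  "x_cp A b c \<mu> \<equiv> fst (central_path A b c \<mu>)"

abbreviation s_cp :: "real^'n^'m \<Rightarrow> real^'m \<Rightarrow> real^'n \<Rightarrow> real \<Rightarrow> real^'n" where
  "s_cp A b c \<mu> \<equiv> snd (central_path A b c \<mu>)"

text \<open>
  \<open>polarized A b c \<gamma> \<mu>1 \<mu>0 B N\<close>: the segment of the central path between \<^term>\<open>\<mu>1\<close> (end) and
  \<^term>\<open>\<mu>0\<close> (start) is \<^term>\<open>\<gamma>\<close>-polarized with partition \<^term>\<open>(B, N)\<close>.
\<close>

definition polarized ::
    "real^'n^'m \<Rightarrow> real^'m \<Rightarrow> real^'n \<Rightarrow> real \<Rightarrow> real \<Rightarrow> real \<Rightarrow> 'n set \<Rightarrow> 'n set \<Rightarrow> bool" where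
  "polarized A b c \<gamma> \<mu>1 \<mu>0 B N \<longleftrightarrow>
     0 < \<gamma> \<and> \<gamma> \<le> 1 \<and> 0 \<le> \<mu>1 \<and> \<mu>1 < \<mu>0 \<and>
     B \<union> N = UNIV \<and> B \<inter> N = {} \<and>
     (\<forall>\<mu>\<in>{\<mu>1..\<mu>0}.
        (\<forall>i\<in>B. x_cp A b c \<mu> $ i \<ge> \<gamma> * x_cp A b c \<mu>0 $ i) \<and>
        (\<forall>i\<in>N. s_cp A b c \<mu> $ i \<ge> \<gamma> * s_cp A b c \<mu>0 $ i))"

text \<open>
  Under strict feasibility of both programs the suprema below range, for \<^term>\<open>g \<ge> 0\<close>, over nonempty
  compact sets, so they are maxima.
\<close>

definition x_max :: "real^'n^'m \<Rightarrow> real^'m \<Rightarrow> real^'n \<Rightarrow> 'n \<Rightarrow> real \<Rightarrow> real" where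
  "x_max A b c i g =
     Sup {x $ i | x. x \<in> primal_feasible A b \<and> c \<bullet> x \<le> opt_value A b c + g}"

definition s_max :: "real^'n^'m \<Rightarrow> real^'m \<Rightarrow> real^'n \<Rightarrow> 'n \<Rightarrow> real \<Rightarrow> real" where
  "s_max A b c i g =
     Sup {s $ i | y s. (y, s) \<in> dual_feasible A c \<and> b \<bullet> y \<ge> opt_value A b c - g}"

definition neighborhood :: "(real \<Rightarrow> real) \<Rightarrow> real \<Rightarrow> (real \<times> real) set" where
  "neighborhood f \<theta> = {(g, z). 0 \<le> g \<and> 0 \<le> z \<and> (1 - \<theta>) * f g \<le> z \<and> z \<le> f g}"

text \<open>
  Straight-line complexity of a function: the least number of pieces of a polygonal curve inside
  the neighborhood, leading from abscissa \<open>gu\<close> to abscissa \<open>gl\<close>.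
\<close>

definition slc :: "(real \<Rightarrow> real) \<Rightarrow> real \<Rightarrow> real \<Rightarrow> real \<Rightarrow> nat" where
  "slc f \<theta> gl gu =
     (LEAST p. 1 \<le> p \<and>
        (\<exists>(g :: nat \<Rightarrow> real) (z :: nat \<Rightarrow> real).
           (\<forall>k\<in>{1..p+1}. 0 \<le> g k \<and> 0 \<le> z k) \<and>
           g 1 = gu \<and> g (p + 1) = gl \<and>
           (\<forall>k\<in>{1..p}. closed_segment (g k, z k) (g (k + 1), z (k + 1)) \<subseteq> neighborhood f \<theta>)))"

definition SLC_primal ::
    "real^'n^'m \<Rightarrow> real^'m \<Rightarrow> real^'n \<Rightarrow> 'n \<Rightarrow> real \<Rightarrow> real \<Rightarrow> real \<Rightarrow> nat" where
  "SLC_primal A b c i \<theta> = slc (x_max A b c i) \<theta>"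

definition SLC_dual ::
    "real^'n^'m \<Rightarrow> real^'m \<Rightarrow> real^'n \<Rightarrow> 'n \<Rightarrow> real \<Rightarrow> real \<Rightarrow> real \<Rightarrow> nat" where
  "SLC_dual A b c i \<theta> = slc (s_max A b c i) \<theta>"

end

(*
  Duality gives x_i(mu) <= x_i^m(n mu) <= 2 n x_i(mu) for every coordinate of the central path, and
  the same for s. Hence on one affine piece z(g) = alpha + beta g of a polygon in the neighbourhood
  of x_i^m, x_i follows z and s_i = mu / x_i follows g / z up to constants. If alpha, beta > 0, then
  towards smaller g the quotient g / z loses at most a factor 2 as long as beta g >= alpha, and z
  loses at most a factor 2 afterwards; otherwise one of the two is monotone. So each piece is cut
  once, with label N before and B after the cut, and every coordinate contributes at most
  2 SLC - 1 breakpoints and 2 SLC label changes, counting the initial one. The dual bound is the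
  same argument for the swapped pair of programs.
*)

theory Submission
  imports Defs
begin

section \<open>Merging labelled subdivisions\<close>

text \<open>The constant 4n is 2 * 2n: 2n is the price for replacing a path coordinate by its
  maximum over a sublevel set, 2 the price of an affine piece; 1 - \<theta> comes from the lower
  edge of the neighbourhood. Three obstacles shape the rest. Labels cannot be chosen separately on
  each cell of the common refinement, since a coordinate for which both alternatives hold could then
  flip at breakpoints of other coordinates. \<open>slc\<close> is a \<open>LEAST\<close>, about
  which nothing is known unless some polygon exists; hence the maxima are shown to be piecewise
  affine on bounded intervals. And \<mu>1 = 0 is allowed, where the path is defined by a limit; its
  existence follows because any two cluster points of the path coincide.\<close>

lemma finite_descending_enumeration:
  fixes D :: "real set"
  assumes "finite D" "D \<subseteq> {l<..<u}" "l < u"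
  shows "\<exists>h :: nat \<Rightarrow> real. h 0 = u \<and> h (Suc (card D)) = l \<and>
    (\<forall>k\<le>card D. h (Suc k) < h k \<and> D \<inter> {h (Suc k)<..<h k} = {})"
  using assms
proof (induction D arbitrary: u rule: finite_linorder_max_induct)
  case empty
  then show ?case by (intro exI[of _ "\<lambda>k. if k = 0 then u else l"]) auto
next
  case (insert d D)
  have "D \<subseteq> {l<..<d}" "l < d" using insert by auto
  from insert.IH[OF this] obtain h where h: "h 0 = d" "h (Suc (card D)) = l"
    "\<forall>k\<le>card D. h (Suc k) < h k \<and> D \<inter> {h (Suc k)<..<h k} = {}"
    by blast
  have h_le: "k \<le> Suc (card D) \<Longrightarrow> h k \<le> d" for k
  proof (induction k)
    case (Suc k)
    then show ?case using h(3)[rule_format, of k] by auto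
  qed (simp add: h)
  have card: "card (insert d D) = Suc (card D)"
    using insert by (subst card_insert_disjoint) auto
  define h' where "h' = case_nat u h"
  have "h' (Suc k) < h' k \<and> insert d D \<inter> {h' (Suc k)<..<h' k} = {}" if "k \<le> Suc (card D)" for k
  proof (cases k)
    case 0
    then show ?thesis using h(1) insert by (auto simp: h'_def)
  next
    case (Suc j)
    then show ?thesis using h(3) h_le[of j] that by (auto simp: h'_def)
  qed
  then show ?case using h card by (intro exI[of _ h']) (auto simp: h'_def)
qed

text \<open>Each coordinate gets one label per cell of its own \<open>D i\<close>. Monotonicity in
  the interval makes this possible: if P fails on a part of such a cell, it fails on the whole cell,
  so Q holds on all of it.\<close>

lemma merge_labelled_partitions:
  fixes D :: "'i :: finite \<Rightarrow> real set" and P Q :: "'i \<Rightarrow> real \<Rightarrow> real \<Rightarrow> bool"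
  assumes "l < u"
    and D: "\<And>i. finite (D i)" "\<And>i. D i \<subseteq> {l<..<u}" "\<And>i. card (D i) + 1 \<le> K i"
    and PQ: "\<And>i a b. l \<le> a \<Longrightarrow> a < b \<Longrightarrow> b \<le> u \<Longrightarrow> D i \<inter> {a<..<b} = {} \<Longrightarrow> P i a b \<or> Q i a b"
    and P_mono: "\<And>i a b a' b'. P i a b \<Longrightarrow> a \<le> a' \<Longrightarrow> b' \<le> b \<Longrightarrow> P i a' b'"
    and Q_mono: "\<And>i a b a' b'. Q i a b \<Longrightarrow> a \<le> a' \<Longrightarrow> b' \<le> b \<Longrightarrow> Q i a' b'"
  obtains T :: nat and h N where "h 0 = u" "h T = l" "\<And>k. k \<in> {1..T} \<Longrightarrow> h k < h (k - 1)"
    and "\<And>k i. k \<in> {1..T} \<Longrightarrow> i \<notin> N k \<Longrightarrow> P i (h k) (h (k - 1))"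
    and "\<And>k i. k \<in> {1..T} \<Longrightarrow> i \<in> N k \<Longrightarrow> Q i (h k) (h (k - 1))"
    and "N 0 = {}" "max (\<Sum>k=1..T. card (sym_diff (N k) (N (k - 1)))) T \<le> (\<Sum>i\<in>UNIV. K i)"
proof -
  define E where "E = (\<Union>i. D i)"
  define T where "T = Suc (card E)"
  have "finite E" "E \<subseteq> {l<..<u}" using D by (auto simp: E_def)
  from finite_descending_enumeration[OF this \<open>l < u\<close>]
  obtain h where h0: "h 0 = u" and hT: "h T = l"
    and hS: "\<And>k. k < T \<Longrightarrow> h (Suc k) < h k \<and> E \<inter> {h (Suc k)<..<h k} = {}"
    unfolding T_def less_Suc_eq_le by blast
  have h_mono: "j < k \<Longrightarrow> k \<le> T \<Longrightarrow> h k < h j" for j k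
  proof (induction k)
    case (Suc k)
    then show ?case using hS[of k] by (cases "j = k") auto
  qed simp
  \<comment> \<open>\<open>t\<close> is the right end of a cell of the refinement. Quantifying over
    all \<open>D i\<close>-free intervals reaching below \<open>t\<close> avoids naming the cell of
    \<open>D i\<close> that contains the points just below \<open>t\<close>.\<close>
  define lab where "lab i t \<longleftrightarrow>
    (\<exists>a b. l \<le> a \<and> a < t \<and> t \<le> b \<and> b \<le> u \<and> D i \<inter> {a<..<b} = {} \<and> \<not> P i a b)" for i t
  define N where "N k = (if k = 0 then {} else {i. lab i (h (k - 1))})" for k
  have lu: "l \<le> h k" "h k \<le> u" if "k \<le> T" for k
    using that h_mono[of k T] h_mono[of 0 k] h0 hT
    by (cases "k = T"; cases "k = 0"; force)+
  \<comment> \<open>As \<open>h (Suc k)\<close> is no breakpoint of coordinate i, the cells on both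
    sides lie in one cell of \<open>D i\<close>; a witness interval for one is enlarged to a witness
    for the other.\<close>
  have lab_const: "lab i (h (Suc k)) \<longleftrightarrow> lab i (h k)"
    if k: "Suc k < T" and n: "h (Suc k) \<notin> D i" for i k
  proof
    have free: "D i \<inter> {h (Suc k)..<h k} = {}" "h (Suc k) < h k" "h k \<le> u" "l \<le> h (Suc (Suc k))"
      "D i \<inter> {h (Suc (Suc k))<..<h (Suc k)} = {}" "h (Suc (Suc k)) < h (Suc k)"
      using hS[of k] hS[of "Suc k"] k n lu[of k] lu[OF Suc_leI[OF k]]
      by (auto simp: E_def disjoint_iff order_le_less)
    show "lab i (h k)" if lab_i: "lab i (h (Suc k))"
    proof -
      obtain a b where ab: "l \<le> a" "a < h (Suc k)" "h (Suc k) \<le> b" "b \<le> u"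
        "D i \<inter> {a<..<b} = {}" "\<not> P i a b"
        using lab_i unfolding lab_def by blast
      have "D i \<inter> {a<..<max b (h k)} = {}"
        using ab(5) free(1) ab(3) by (force simp: disjoint_iff)
      moreover have "\<not> P i a (max b (h k))"
        using ab(6) P_mono[of i a "max b (h k)" a b] by auto
      ultimately show ?thesis
        unfolding lab_def using ab free by (intro exI[of _ a] exI[of _ "max b (h k)"]) auto
    qed
    show "lab i (h (Suc k))" if lab_i: "lab i (h k)"
    proof -
      obtain a b where ab: "l \<le> a" "a < h k" "h k \<le> b" "b \<le> u"
        "D i \<inter> {a<..<b} = {}" "\<not> P i a b"
        using lab_i unfolding lab_def by blast
      define a' where "a' = min a (h (Suc (Suc k)))"
      have "D i \<inter> {a'<..<b} = {}"
      proof (rule ccontr)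
        assume "D i \<inter> {a'<..<b} \<noteq> {}"
        then obtain t where t: "t \<in> D i" "a' < t" "t < b" by auto
        have "t \<noteq> h (Suc k)" using n t by auto
        then have "t \<notin> {h (Suc (Suc k))<..<h k}" using free t by (auto simp: disjoint_iff)
        then have "t \<le> h (Suc (Suc k)) \<or> h k \<le> t" by auto
        then show False using ab t free unfolding a'_def by (force simp: disjoint_iff min_def split: if_splits)
      qed
      moreover have "\<not> P i a' b"
        using ab(6) P_mono[of i a' b a b] by (auto simp: a'_def)
      ultimately show ?thesis
        unfolding lab_def using ab free by (intro exI[of _ a'] exI[of _ b]) (auto simp: a'_def)
    qed
  qed
  have PQ_cell: "(i \<notin> N k \<longrightarrow> P i (h k) (h (k - 1))) \<and> (i \<in> N k \<longrightarrow> Q i (h k) (h (k - 1)))"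
    if k: "k \<in> {1..T}" for i k
  proof -
    obtain j where j: "k = Suc j" "j < T" using k by (cases k) auto
    have free: "D i \<inter> {h (Suc j)<..<h j} = {}" "h (Suc j) < h j" "h j \<le> u" "l \<le> h (Suc j)"
      using hS[of j] j lu[of j] lu[of "Suc j"] by (auto simp: E_def)
    have "P i (h (Suc j)) (h j)" if "\<not> lab i (h j)"
      using that free unfolding lab_def by blast
    moreover have "Q i (h (Suc j)) (h j)" if lab_i: "lab i (h j)"
    proof -
      obtain a b where ab: "l \<le> a" "a < h j" "h j \<le> b" "b \<le> u"
        "D i \<inter> {a<..<b} = {}" "\<not> P i a b"
        using lab_i unfolding lab_def by blast
      define a' where "a' = min a (h (Suc j))"
      have "D i \<inter> {a'<..<b} = {}"
      proof (rule ccontr)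
        assume "D i \<inter> {a'<..<b} \<noteq> {}"
        then obtain t where t: "t \<in> D i" "a' < t" "t < b" by auto
        then have "t \<notin> {h (Suc j)<..<h j}" using free by (auto simp: disjoint_iff)
        then have "t \<le> h (Suc j) \<or> h j \<le> t" by auto
        then show False using ab t free unfolding a'_def by (force simp: disjoint_iff min_def split: if_splits)
      qed
      moreover have "\<not> P i a' b"
        using ab(6) P_mono[of i a' b a b] by (auto simp: a'_def)
      moreover have "l \<le> a'" "a' < b" using ab free by (auto simp: a'_def)
      ultimately have "Q i a' b" using PQ ab by blast
      then show ?thesis using Q_mono ab by (auto simp: a'_def)
    qed
    ultimately show ?thesis by (auto simp: N_def j)
  qed
  have changes: "card {k\<in>{1..T}. i \<in> sym_diff (N k) (N (k - 1))} \<le> K i" for i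
  proof -
    let ?C = "{k\<in>{1..T}. i \<in> sym_diff (N k) (N (k - 1))}"
    \<comment> \<open>Index 1 is set aside: it carries the change against \<open>N 0 = {}\<close>,
      which happens at \<open>u\<close> and not at a point of \<open>D i\<close>.\<close>
    have "card (?C - {1}) \<le> card (D i)"
    proof (rule card_inj_on_le[where f = "\<lambda>k. h (k - 1)"])
      show "inj_on (\<lambda>k. h (k - 1)) (?C - {1})"
      proof (rule inj_onI)
        fix j k assume jk: "j \<in> ?C - {1}" "k \<in> ?C - {1}" "h (j - 1) = h (k - 1)"
        then have "\<not> j - 1 < k - 1" "\<not> k - 1 < j - 1"
          using h_mono[of "j - 1" "k - 1"] h_mono[of "k - 1" "j - 1"] by fastforce+
        then show "j = k" using jk by auto
      qed
      show "(\<lambda>k. h (k - 1)) ` (?C - {1}) \<subseteq> D i"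
      proof (rule image_subsetI)
        fix k assume "k \<in> ?C - {1}"
        then have k: "k \<in> {1..T}" "i \<in> sym_diff (N k) (N (k - 1))" "k \<noteq> 1" by auto
        define j where "j = k - 2"
        have j: "k = Suc (Suc j)" "Suc j < T" using k by (auto simp: j_def)
        show "h (k - 1) \<in> D i"
          using k(2) lab_const[of j i] j by (auto simp: N_def)
      qed
    qed (rule D)
    moreover have "card X \<le> card (X - {1}) + 1" for X :: "nat set"
      by (cases "finite X") (auto simp add: card_Diff_singleton_if)
    from this[of ?C] have "card ?C \<le> card (?C - {1}) + 1" .
    ultimately show ?thesis using D(3)[of i] by linarith
  qed
  have card_sum: "card M = (\<Sum>i\<in>UNIV. if i \<in> M then 1 else 0)" for M :: "'i set"
    by (simp add: sum.If_cases)
  have "(\<Sum>k=1..T. card (sym_diff (N k) (N (k - 1))))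
      = (\<Sum>k=1..T. \<Sum>i\<in>UNIV. if i \<in> sym_diff (N k) (N (k - 1)) then 1 else 0)"
    by (simp only: card_sum)
  also have "\<dots> = (\<Sum>i\<in>UNIV. card {k\<in>{1..T}. i \<in> sym_diff (N k) (N (k - 1))})"
    by (subst sum.swap) (simp add: sum.If_cases Int_def conj_commute)
  also have "\<dots> \<le> (\<Sum>i\<in>UNIV. K i)" by (intro sum_mono changes)
  finally have sum_le: "(\<Sum>k=1..T. card (sym_diff (N k) (N (k - 1)))) \<le> (\<Sum>i\<in>UNIV. K i)" .
  \<comment> \<open>There is one cell more than distinct breakpoints; as there is at least one
    coordinate, the additional 1 fits into the sum of the \<open>card (D i) + 1\<close>.\<close>
  have "T \<le> Suc (\<Sum>i\<in>UNIV. card (D i))"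
    unfolding T_def E_def by (simp add: card_UN_le)
  also have "\<dots> \<le> (\<Sum>i\<in>(UNIV :: 'i set). card (D i)) + CARD('i)"
    by (simp add: Suc_le_eq)
  also have "\<dots> = (\<Sum>i\<in>UNIV. card (D i) + 1)" by (simp only: sum.distrib card_eq_sum)
  also have "\<dots> \<le> (\<Sum>i\<in>UNIV. K i)" by (intro sum_mono D)
  finally have "T \<le> (\<Sum>i\<in>UNIV. K i)" .
  moreover have "h k < h (k - 1)" if "k \<in> {1..T}" for k
    using that hS[of "k - 1"] by auto
  ultimately show ?thesis
    using h0 hT PQ_cell sum_le by (intro that[of h T N]) (auto simp: N_def)
qed

text \<open>The abscissae of a polygon need not be monotone, so the last vertex with
  \<open>b \<le> g k\<close> is taken: its successor lies below \<open>b\<close>, and, as no inner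
  vertex lies over the open interval, at or below \<open>a\<close>.\<close>

lemma polygon_covers_interval:
  fixes g :: "nat \<Rightarrow> real"
  assumes g: "g 1 = gu" "g (p + 1) = gl" and ab: "gl \<le> a" "a < b" "b \<le> gu"
    and free: "g ` {2..p} \<inter> {a<..<b} = {}"
  shows "\<exists>k\<in>{1..p}. g (k + 1) \<le> a \<and> b \<le> g k"
proof -
  define S where "S = {k\<in>{1..p + 1}. b \<le> g k}"
  define k where "k = Max S"
  have "finite S" "1 \<in> S" using g ab by (auto simp: S_def)
  then have k: "k \<in> S" "\<And>j. j \<in> S \<Longrightarrow> j \<le> k"
    unfolding k_def by (auto intro!: Max_in)
  have "k \<noteq> p + 1" using k(1) g ab by (auto simp: S_def)
  then have k1: "k \<in> {1..p}" using k(1) by (auto simp: S_def)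
  have "k + 1 \<notin> S" using k(2)[of "k + 1"] by auto
  then have lt: "g (k + 1) < b" using k1 by (auto simp: S_def)
  have "g (k + 1) \<le> a"
  proof (cases "k = p")
    case False
    then have "g (k + 1) \<in> g ` {2..p}" using k1 by auto
    then show ?thesis using free lt by (auto simp: disjoint_iff)
  qed (use g ab in auto)
  then show ?thesis using k1 k(1) by (auto simp: S_def)
qed

section \<open>Affine pieces of a polygon\<close>

text \<open>All pairs are compared, not only those with the right end as in
  \<open>polarized\<close>, so that the property passes to subintervals. The point 0 is left out
  because \<open>X \<mu> * S \<mu> = \<mu>\<close> is available only for positive \<mu>.\<close>

definition almost_decreasing :: "real \<Rightarrow> (real \<Rightarrow> real) \<Rightarrow> real \<Rightarrow> real \<Rightarrow> bool" where
  "almost_decreasing \<gamma> X l u \<longleftrightarrow> (\<forall>\<mu> \<mu>'. 0 < \<mu> \<and> l \<le> \<mu> \<and> \<mu> \<le> \<mu>' \<and> \<mu>' \<le> u \<longrightarrow> \<gamma> * X \<mu>' \<le> X \<mu>)"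

lemma almost_decreasing_mono:
  "almost_decreasing \<gamma> X l u \<Longrightarrow> l \<le> l' \<Longrightarrow> u' \<le> u \<Longrightarrow> almost_decreasing \<gamma> X l' u'"
  unfolding almost_decreasing_def by (meson order_trans)

text \<open>Only \<mu> = 0 needs an argument: there the inequality passes to the one-sided
  limit.\<close>

lemma almost_decreasing_right_end:
  assumes X: "(X \<longlongrightarrow> X 0) (at_right 0)" and dec: "almost_decreasing \<gamma> X l u"
    and \<mu>: "0 \<le> l" "l < u" "\<mu> \<in> {l..u}"
  shows "\<gamma> * X u \<le> X \<mu>"
proof (cases "0 < \<mu>")
  case True
  then show ?thesis using dec \<mu> unfolding almost_decreasing_def by auto
next
  case False
  then have zero: "\<mu> = 0" "l = 0" using \<mu> by auto
  have "\<forall>\<^sub>F \<nu> in at_right 0. \<gamma> * X u \<le> X \<nu>"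
    unfolding eventually_at_right_field
    using dec \<mu> zero by (intro exI[of _ u]) (auto simp: almost_decreasing_def)
  then show ?thesis
    unfolding zero using tendsto_lowerbound[OF X] by simp
qed

text \<open>All that the counting argument uses about one coordinate. It is instantiated with x, s
  and the primal maximum, and again with s, x and the dual maximum.\<close>

locale reciprocal_pair =
  fixes X S f :: "real \<Rightarrow> real" and n \<theta> :: real
  assumes n: "0 < n" and \<theta>: "\<theta> < 1"
    and X_pos: "0 < \<mu> \<Longrightarrow> 0 < X \<mu>"
    and XS: "0 < \<mu> \<Longrightarrow> X \<mu> * S \<mu> = \<mu>"
    and X_le: "0 < \<mu> \<Longrightarrow> X \<mu> \<le> f (n * \<mu>)"
    and f_le: "0 < \<mu> \<Longrightarrow> f (n * \<mu>) \<le> 2 * n * X \<mu>"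
begin

text \<open>\<open>(1 - \<theta>) * X \<mu>' \<le> z' \<le> 2 * z \<le> 4 * n * X \<mu>\<close>,
  where \<open>z'\<close> and \<open>z\<close> are polygon heights over \<open>n * \<mu>'\<close>
  and \<open>n * \<mu>\<close>.\<close>

lemma X_step:
  assumes "0 < \<mu>" "0 < \<mu>'" and "(1 - \<theta>) * f (n * \<mu>') \<le> z'" "z \<le> f (n * \<mu>)" "z' \<le> 2 * z"
  shows "(1 - \<theta>) / (4 * n) * X \<mu>' \<le> X \<mu>"
proof -
  have "(1 - \<theta>) * X \<mu>' \<le> (1 - \<theta>) * f (n * \<mu>')"
    using X_le assms \<theta> by (intro mult_left_mono) auto
  also have "\<dots> \<le> 4 * n * X \<mu>" using assms f_le[of \<mu>] by linarith
  finally show ?thesis using n by (simp add: field_simps)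
qed

text \<open>Since \<open>S \<mu> = \<mu> / X \<mu>\<close>, the claim compares
  \<open>\<mu>' * X \<mu>\<close> with \<open>\<mu> * X \<mu>'\<close>; the lower edge of the
  neighbourhood is now used at \<mu> and the upper edge at \<mu>', opposite to
  \<open>X_step\<close>.\<close>

lemma S_step:
  assumes \<mu>: "0 < \<mu>" "0 < \<mu>'" and "(1 - \<theta>) * f (n * \<mu>) \<le> z" "z' \<le> f (n * \<mu>')"
    and z: "\<mu>' * z \<le> 2 * (\<mu> * z')"
  shows "(1 - \<theta>) / (4 * n) * S \<mu>' \<le> S \<mu>"
proof -
  have S_eq: "S \<mu> = \<mu> / X \<mu>" if "0 < \<mu>" for \<mu>
    using XS[OF that] X_pos[OF that] by (simp add: field_simps)
  have "(1 - \<theta>) * X \<mu> \<le> (1 - \<theta>) * f (n * \<mu>)"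
    using X_le assms \<theta> by (intro mult_left_mono) auto
  then have "\<mu>' * ((1 - \<theta>) * X \<mu>) \<le> \<mu>' * z" using assms by (intro mult_left_mono) auto
  also note z
  also have "2 * (\<mu> * z') \<le> 2 * (\<mu> * (2 * n * X \<mu>'))"
    using assms f_le[of \<mu>'] by (intro mult_left_mono) auto
  finally show ?thesis
    using n X_pos[OF \<mu>(1)] X_pos[OF \<mu>(2)] by (simp add: S_eq \<mu> field_simps)
qed

text \<open>
  On an affine piece \<open>z(g) = \<alpha> + \<beta> * g\<close>, either \<open>z\<close> or \<open>g / z(g)\<close> decreases by at most a factor 2
  towards smaller \<open>g\<close>, as long as the break-even point \<open>g = \<alpha> / \<beta>\<close> is not crossed.
\<close>

lemma affine_piece:
  assumes z: "\<And>g. n * a \<le> g \<Longrightarrow> g \<le> n * b \<Longrightarrow> 0 \<le> \<alpha> + \<beta> * g \<and>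
      (1 - \<theta>) * f g \<le> \<alpha> + \<beta> * g \<and> \<alpha> + \<beta> * g \<le> f g"
    and split: "\<alpha> / \<beta> / n \<notin> {a<..<b}"
  shows "almost_decreasing ((1 - \<theta>) / (4 * n)) X a b \<or> almost_decreasing ((1 - \<theta>) / (4 * n)) S a b"
proof -
  have zn: "0 \<le> \<alpha> + \<beta> * (n * \<mu>)" "(1 - \<theta>) * f (n * \<mu>) \<le> \<alpha> + \<beta> * (n * \<mu>)"
      "\<alpha> + \<beta> * (n * \<mu>) \<le> f (n * \<mu>)"
    if "a \<le> \<mu>" "\<mu> \<le> b" for \<mu>
    using z[of "n * \<mu>"] that n by auto
  \<comment> \<open>Without a positive break-even point one alternative holds throughout: z is
    antitone for \<beta> \<le> 0, and g / z is antitone for \<alpha> \<le> 0 where z is positive. In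
    particular \<beta> = 0 never relies on the value of \<open>\<alpha> / \<beta>\<close>.\<close>
  consider "\<beta> \<le> 0 \<or> (0 < \<alpha> \<and> 0 < \<beta> \<and> b \<le> \<alpha> / \<beta> / n)"
    | "\<alpha> \<le> 0 \<or> (0 < \<alpha> \<and> 0 < \<beta> \<and> \<alpha> / \<beta> / n \<le> a)"
    using split by force
  then show ?thesis
  proof cases
    case 1
    have "almost_decreasing ((1 - \<theta>) / (4 * n)) X a b"
      unfolding almost_decreasing_def
    proof (intro allI impI, elim conjE)
      fix \<mu> \<mu>' assume \<mu>: "0 < \<mu>" "a \<le> \<mu>" "\<mu> \<le> \<mu>'" "\<mu>' \<le> b"
      have "\<alpha> + \<beta> * (n * \<mu>') \<le> 2 * (\<alpha> + \<beta> * (n * \<mu>))"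
        using 1
      proof (elim disjE conjE)
        assume "\<beta> \<le> 0"
        then have "\<beta> * (n * \<mu>') \<le> \<beta> * (n * \<mu>)" using \<mu> n by (intro mult_left_mono_neg mult_left_mono) auto
        then show ?thesis using zn(1)[of \<mu>] \<mu> by auto
      next
        assume ab: "0 < \<alpha>" "0 < \<beta>" "b \<le> \<alpha> / \<beta> / n"
        then have "\<mu>' \<le> \<alpha> / \<beta> / n" using \<mu> by simp
        then have "\<beta> * (n * \<mu>') \<le> \<alpha>" using ab n by (simp add: field_simps)
        moreover have "0 \<le> \<beta> * (n * \<mu>)" using ab \<mu> n by simp
        ultimately show ?thesis by (simp add: distrib_left)
      qed
      then show "(1 - \<theta>) / (4 * n) * X \<mu>' \<le> X \<mu>"
        using \<mu> zn(2)[of \<mu>'] zn(3)[of \<mu>] by (intro X_step) auto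
    qed
    then show ?thesis ..
  next
    case 2
    have "almost_decreasing ((1 - \<theta>) / (4 * n)) S a b"
      unfolding almost_decreasing_def
    proof (intro allI impI, elim conjE)
      fix \<mu> \<mu>' assume \<mu>: "0 < \<mu>" "a \<le> \<mu>" "\<mu> \<le> \<mu>'" "\<mu>' \<le> b"
      have "\<mu>' * (\<alpha> + \<beta> * (n * \<mu>)) \<le> 2 * (\<mu> * (\<alpha> + \<beta> * (n * \<mu>')))"
        using 2
      proof (elim disjE conjE)
        assume "\<alpha> \<le> 0"
        then have "\<mu>' * \<alpha> \<le> \<mu> * \<alpha>" using \<mu> by (intro mult_right_mono_neg) auto
        then have "\<mu>' * (\<alpha> + \<beta> * (n * \<mu>)) \<le> \<mu> * (\<alpha> + \<beta> * (n * \<mu>'))"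
          by (simp add: algebra_simps)
        moreover have "0 \<le> \<mu> * (\<alpha> + \<beta> * (n * \<mu>'))" using \<mu> zn(1)[of \<mu>'] by simp
        ultimately show ?thesis by linarith
      next
        assume ab: "0 < \<alpha>" "0 < \<beta>" "\<alpha> / \<beta> / n \<le> a"
        then have "\<alpha> / \<beta> / n \<le> \<mu>" using \<mu> by simp
        \<comment> \<open>Above the break-even point z is at most twice its linear part, and the
          quotient of g and that linear part is constant.\<close>
        then have "\<alpha> \<le> \<beta> * (n * \<mu>)" using ab n by (simp add: field_simps)
        then have "\<mu>' * (\<alpha> + \<beta> * (n * \<mu>)) \<le> \<mu>' * (\<beta> * (n * \<mu>) + \<beta> * (n * \<mu>))"
          using \<mu> by (intro mult_left_mono add_right_mono) auto
        also have "\<dots> = 2 * (\<mu> * (\<beta> * (n * \<mu>')))" by simp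
        also have "\<dots> \<le> 2 * (\<mu> * (\<alpha> + \<beta> * (n * \<mu>')))" using \<mu> ab by simp
        finally show ?thesis .
      qed
      then show "(1 - \<theta>) / (4 * n) * S \<mu>' \<le> S \<mu>"
        using \<mu> zn(2)[of \<mu>] zn(3)[of \<mu>'] by (intro S_step) auto
    qed
    then show ?thesis ..
  qed
qed

end

section \<open>Breakpoints of a single coordinate\<close>

lemma closed_segment_affine:
  fixes g g' z z' t :: real
  assumes "g' < g" "g' \<le> t" "t \<le> g"
  shows "(t, z' - (z - z') / (g - g') * g' + (z - z') / (g - g') * t) \<in> closed_segment (g, z) (g', z')"
proof -
  define u where "u = (g - t) / (g - g')"
  have u: "0 \<le> u" "u \<le> 1" using assms by (auto simp: u_def field_simps)
  define w where "w = (z - z') / (g - g')"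
  have "u * (g - g') = g - t" and w: "w * (g - g') = z - z'" using assms by (auto simp: u_def w_def)
  then have t: "t = (1 - u) * g + u * g'" by (simp add: algebra_simps)
  have "w * (t - g') = (1 - u) * (w * (g - g'))" unfolding t by (simp add: algebra_simps)
  then have "z' - w * g' + w * t = (1 - u) * z + u * z'"
    unfolding w by (simp add: algebra_simps)
  then show ?thesis using u t unfolding w_def by (auto simp: in_segment)
qed

text \<open>The predicate minimized in \<open>slc\<close>, named so that the existence of some p, on
  which the meaning of \<open>LEAST\<close> depends, can be treated separately.\<close>

definition polygon_within :: "(real \<Rightarrow> real) \<Rightarrow> real \<Rightarrow> real \<Rightarrow> real \<Rightarrow> nat \<Rightarrow> bool" where
  "polygon_within f \<theta> gl gu p \<longleftrightarrow> 1 \<le> p \<and>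
     (\<exists>(g :: nat \<Rightarrow> real) (z :: nat \<Rightarrow> real).
        (\<forall>k\<in>{1..p+1}. 0 \<le> g k \<and> 0 \<le> z k) \<and> g 1 = gu \<and> g (p + 1) = gl \<and>
        (\<forall>k\<in>{1..p}. closed_segment (g k, z k) (g (k + 1), z (k + 1)) \<subseteq> neighborhood f \<theta>))"

lemma slc_eq_Least: "slc f \<theta> gl gu = (LEAST p. polygon_within f \<theta> gl gu p)"
  by (simp add: slc_def polygon_within_def)

context reciprocal_pair
begin

text \<open>A polygon with p segments has p - 1 inner vertices and p break-even points, 2p - 1 in
  all. An interval free of them lies under one segment and on one side of its break-even
  point.\<close>

lemma slc_breakpoints:
  assumes "\<exists>p. polygon_within f \<theta> (n * \<mu>1) (n * \<mu>0) p"
  shows "\<exists>D. finite D \<and> D \<subseteq> {\<mu>1<..<\<mu>0} \<and> card D + 1 \<le> 2 * slc f \<theta> (n * \<mu>1) (n * \<mu>0) \<and>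
    (\<forall>a b. \<mu>1 \<le> a \<longrightarrow> a < b \<longrightarrow> b \<le> \<mu>0 \<longrightarrow> D \<inter> {a<..<b} = {} \<longrightarrow>
      almost_decreasing ((1 - \<theta>) / (4 * n)) X a b \<or> almost_decreasing ((1 - \<theta>) / (4 * n)) S a b)"
proof -
  define p where "p = slc f \<theta> (n * \<mu>1) (n * \<mu>0)"
  have "polygon_within f \<theta> (n * \<mu>1) (n * \<mu>0) p"
    unfolding p_def slc_eq_Least using assms by (rule LeastI_ex)
  then obtain g z where p: "1 \<le> p" and g: "g 1 = n * \<mu>0" "g (p + 1) = n * \<mu>1"
    and seg: "\<And>k. k \<in> {1..p} \<Longrightarrow>
      closed_segment (g k, z k) (g (k + 1), z (k + 1)) \<subseteq> neighborhood f \<theta>"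
    unfolding polygon_within_def by blast
  define \<beta> where "\<beta> k = (z k - z (k + 1)) / (g k - g (k + 1))" for k
  define \<alpha> where "\<alpha> k = z (k + 1) - \<beta> k * g (k + 1)" for k
  define D where "D = ((\<lambda>k. g k / n) ` {2..p} \<union> (\<lambda>k. \<alpha> k / \<beta> k / n) ` {1..p}) \<inter> {\<mu>1<..<\<mu>0}"
  have "card D \<le> card ((\<lambda>k. g k / n) ` {2..p} \<union> (\<lambda>k. \<alpha> k / \<beta> k / n) ` {1..p})"
    unfolding D_def by (rule card_mono) auto
  also have "\<dots> \<le> card ((\<lambda>k. g k / n) ` {2..p}) + card ((\<lambda>k. \<alpha> k / \<beta> k / n) ` {1..p})"
    by (rule card_Un_le)
  also have "\<dots> \<le> card {2..p} + card {1..p}" by (intro add_mono card_image_le) auto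
  finally have "card D + 1 \<le> 2 * p" using p by simp
  moreover have "almost_decreasing ((1 - \<theta>) / (4 * n)) X a b \<or>
      almost_decreasing ((1 - \<theta>) / (4 * n)) S a b"
    if ab: "\<mu>1 \<le> a" "a < b" "b \<le> \<mu>0" and free: "D \<inter> {a<..<b} = {}" for a b
  proof -
    have sub: "x / n \<in> {\<mu>1<..<\<mu>0} \<and> x / n \<in> {a<..<b}" if "x \<in> {n * a<..<n * b}" for x
    proof -
      have "a < x / n" "x / n < b" using that n by (simp_all add: field_simps)
      then show ?thesis using ab by auto
    qed
    have "g ` {2..p} \<inter> {n * a<..<n * b} = {}"
      using free sub by (fastforce simp: D_def)
    then obtain k where k: "k \<in> {1..p}" "g (k + 1) \<le> n * a" "n * b \<le> g k"
      using polygon_covers_interval[OF g, of "n * a" "n * b"] ab n by auto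
    have "n * a < n * b" using ab n by simp
    then have "(t, \<alpha> k + \<beta> k * t) \<in> neighborhood f \<theta>" if "n * a \<le> t" "t \<le> n * b" for t
      using closed_segment_affine[of "g (k + 1)" "g k" t "z (k + 1)" "z k"] k that seg[OF k(1)]
      unfolding \<alpha>_def \<beta>_def by auto
    then show ?thesis
    proof (intro affine_piece)
      show "\<alpha> k / \<beta> k / n \<notin> {a<..<b}"
      proof
        assume *: "\<alpha> k / \<beta> k / n \<in> {a<..<b}"
        then have "\<alpha> k / \<beta> k / n \<in> D" using k(1) ab by (auto simp: D_def)
        then show False using free * by blast
      qed
    qed (auto simp: neighborhood_def)
  qed
  ultimately show ?thesis by (intro exI[of _ D]) (auto simp: p_def D_def)
qed

end

section \<open>Polygons in the neighbourhood of a piecewise affine function\<close>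

text \<open>Only half-planes with a positive z-coefficient bound z from above, and over each t one
  of them is tight, since otherwise z could be raised inside P.\<close>

lemma polytope_upper_boundary:
  fixes P :: "(real \<times> real) set" and f :: "real \<Rightarrow> real"
  assumes P: "polytope P"
    and f: "\<And>t. t \<in> {l..u} \<Longrightarrow> (t, f t) \<in> P \<and> (\<forall>z. (t, z) \<in> P \<longrightarrow> z \<le> f t)"
  obtains F where "finite F"
    and "\<And>t. t \<in> {l..u} \<Longrightarrow> \<exists>(\<alpha>, \<beta>)\<in>F. f t = \<alpha> + \<beta> * t"
    and "\<And>t \<alpha> \<beta>. t \<in> {l..u} \<Longrightarrow> (\<alpha>, \<beta>) \<in> F \<Longrightarrow> f t \<le> \<alpha> + \<beta> * t"
proof -
  obtain H where H: "finite H" "P = \<Inter>H" "\<forall>h\<in>H. \<exists>a b. a \<noteq> 0 \<and> h = {x. a \<bullet> x \<le> b}"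
    using polytope_imp_polyhedron[OF P] unfolding polyhedron_def by blast
  then obtain a b where ab: "\<And>h. h \<in> H \<Longrightarrow> h = {x. a h \<bullet> x \<le> b h}" by metis
  have P_iff: "(t, z) \<in> P \<longleftrightarrow> (\<forall>h\<in>H. fst (a h) * t + snd (a h) * z \<le> b h)" for t z
  proof -
    have "(t, z) \<in> h \<longleftrightarrow> fst (a h) * t + snd (a h) * z \<le> b h" if "h \<in> H" for h
      by (subst ab[OF that]) (simp add: inner_prod_def)
    then show ?thesis using H(2) by auto
  qed
  define U where "U = {h\<in>H. 0 < snd (a h)}"
  define F where "F = (\<lambda>h. (b h / snd (a h), - (fst (a h) / snd (a h)))) ` U"
  have line: "z \<le> b h / snd (a h) + - (fst (a h) / snd (a h)) * t \<longleftrightarrow>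
      fst (a h) * t + snd (a h) * z \<le> b h" if "h \<in> U" for h t z
    using that by (auto simp: U_def field_simps)
  have upper: "f t \<le> \<alpha> + \<beta> * t" if "t \<in> {l..u}" "(\<alpha>, \<beta>) \<in> F" for t \<alpha> \<beta>
    using f[OF that(1)] that(2) line unfolding P_iff by (auto simp: F_def U_def)
  have attained: "\<exists>(\<alpha>, \<beta>)\<in>F. f t = \<alpha> + \<beta> * t" if t: "t \<in> {l..u}" for t
  proof (rule ccontr)
    assume no: "\<not> ?thesis"
    define E where "E = (\<lambda>(\<alpha>, \<beta>). \<alpha> + \<beta> * t) ` F"
    have E: "finite E" using H by (auto simp: E_def F_def U_def)
    have lt: "f t < e" if "e \<in> E" for e
      using that no upper[OF t] unfolding E_def by (force simp: order_le_less)
    obtain z where z: "f t < z" "\<And>e. e \<in> E \<Longrightarrow> z \<le> e"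
    proof (cases "E = {}")
      case True
      then show ?thesis using that[of "f t + 1"] by simp
    next
      case False
      then show ?thesis using that[of "Min E"] E lt by simp
    qed
    have "(t, z) \<in> P"
      unfolding P_iff
    proof
      fix h assume h: "h \<in> H"
      show "fst (a h) * t + snd (a h) * z \<le> b h"
      proof (cases "h \<in> U")
        case True
        then have "b h / snd (a h) + - (fst (a h) / snd (a h)) * t \<in> E"
          by (force simp: E_def F_def)
        then show ?thesis using z(2) line[OF True] by blast
      next
        case False
        \<comment> \<open>Raising z can only relax a constraint whose z-coefficient is not
          positive.\<close>
        then have "snd (a h) * z \<le> snd (a h) * f t"
          using h z by (intro mult_left_mono_neg) (auto simp: U_def)
        then show ?thesis using f[OF t] h unfolding P_iff by force
      qed
    qed
    then show False using f[OF t] z by force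
  qed
  have "finite F" using H by (auto simp: F_def U_def)
  from this attained upper show ?thesis by (rule that)
qed

lemma minimum_of_affine_breakpoints:
  fixes F :: "(real \<times> real) set" and f :: "real \<Rightarrow> real"
  assumes "finite F" "l < u"
    and F: "\<And>t. t \<in> {l..u} \<Longrightarrow> \<exists>(\<alpha>, \<beta>)\<in>F. f t = \<alpha> + \<beta> * t"
      "\<And>t \<alpha> \<beta>. t \<in> {l..u} \<Longrightarrow> (\<alpha>, \<beta>) \<in> F \<Longrightarrow> f t \<le> \<alpha> + \<beta> * t"
  obtains D where "finite D" "D \<subseteq> {l<..<u}"
    and "\<And>a b. l \<le> a \<Longrightarrow> a < b \<Longrightarrow> b \<le> u \<Longrightarrow> D \<inter> {a<..<b} = {} \<Longrightarrow>
      \<exists>\<alpha> \<beta>. \<forall>t\<in>{a..b}. f t = \<alpha> + \<beta> * t"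
proof -
  define cross where "cross = (\<lambda>((\<alpha>, \<beta>), (\<alpha>', \<beta>')). (\<alpha>' - \<alpha>) / (\<beta> - \<beta>' :: real))"
  define D where "D = cross ` (F \<times> F) \<inter> {l<..<u}"
  have affine: "\<exists>\<alpha> \<beta>. \<forall>t\<in>{a..b}. f t = \<alpha> + \<beta> * t"
    if ab: "l \<le> a" "a < b" "b \<le> u" and free: "D \<inter> {a<..<b} = {}" for a b
  proof -
    \<comment> \<open>The line active at the midpoint stays active: another line below it at t would
      have to cross it between m and t. As m is interior, the crossing lies in the open interval
      even if t is an end point.\<close>
    define m where "m = (a + b) / 2"
    have m: "m \<in> {l..u}" "a < m" "m < b" using ab by (auto simp: m_def)
    then obtain \<alpha> \<beta> where \<alpha>\<beta>: "(\<alpha>, \<beta>) \<in> F" "f m = \<alpha> + \<beta> * m" using F(1) by blast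
    have "f t = \<alpha> + \<beta> * t" if t: "t \<in> {a..b}" for t
    proof (rule ccontr)
      assume ne: "f t \<noteq> \<alpha> + \<beta> * t"
      have tlu: "t \<in> {l..u}" using t ab by auto
      then obtain \<alpha>' \<beta>' where \<alpha>\<beta>': "(\<alpha>', \<beta>') \<in> F" "f t = \<alpha>' + \<beta>' * t" using F(1) by blast
      define d where "d = (\<lambda>x. (\<alpha>' - \<alpha>) - (\<beta> - \<beta>') * x)"
      have d: "d t < 0" "0 \<le> d m"
        using F(2)[OF tlu \<alpha>\<beta>(1)] F(2)[OF m(1) \<alpha>\<beta>'(1)] ne \<alpha>\<beta> \<alpha>\<beta>'
        by (auto simp: d_def algebra_simps)
      have \<beta>: "\<beta> \<noteq> \<beta>'" using d by (auto simp: d_def)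
      define r where "r = (\<alpha>' - \<alpha>) / (\<beta> - \<beta>')"
      have dr: "d x = (\<beta> - \<beta>') * (r - x)" for x using \<beta> by (simp add: d_def r_def field_simps)
      have "t < r \<and> r \<le> m \<or> m \<le> r \<and> r < t"
        using d \<beta> unfolding dr by (auto simp: mult_less_0_iff zero_le_mult_iff)
      then have "r \<in> {a<..<b}" using t m by auto
      moreover have "r \<in> cross ` (F \<times> F)"
        using \<alpha>\<beta>(1) \<alpha>\<beta>'(1) by (force simp: cross_def r_def)
      ultimately show False using free ab by (auto simp: D_def)
    qed
    then show ?thesis by blast
  qed
  have "finite D" "D \<subseteq> {l<..<u}" using \<open>finite F\<close> by (auto simp: D_def)
  from this affine show ?thesis by (rule that)
qed

text \<open>The graph of f is itself an admissible polygon: it runs along the upper edge of the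
  neighbourhood, and lies above the lower edge since \<theta> and f are nonnegative.\<close>

lemma polygon_within_piecewise_affine:
  fixes f :: "real \<Rightarrow> real"
  assumes D: "finite D" "D \<subseteq> {l<..<u}" and lu: "0 \<le> l" "l < u" and "0 \<le> \<theta>"
    and pos: "\<And>t. t \<in> {l..u} \<Longrightarrow> 0 \<le> f t"
    and affine: "\<And>a b. l \<le> a \<Longrightarrow> a < b \<Longrightarrow> b \<le> u \<Longrightarrow> D \<inter> {a<..<b} = {} \<Longrightarrow>
      \<exists>\<alpha> \<beta>. \<forall>t\<in>{a..b}. f t = \<alpha> + \<beta> * t"
  shows "\<exists>p. polygon_within f \<theta> l u p"
proof -
  define p where "p = Suc (card D)"
  obtain h where h: "h 0 = u" "h p = l"
    and hS: "\<And>k. k < p \<Longrightarrow> h (Suc k) < h k \<and> D \<inter> {h (Suc k)<..<h k} = {}"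
    using finite_descending_enumeration[OF D lu(2)] unfolding p_def less_Suc_eq_le by blast
  have le_u: "k \<le> p \<Longrightarrow> h k \<le> u" for k
  proof (induction k)
    case (Suc k)
    then show ?case using hS[of k] by auto
  qed (simp add: h)
  have l_le: "k \<le> p \<Longrightarrow> l \<le> h (p - k)" for k
  proof (induction k)
    case (Suc k)
    then show ?case using hS[of "p - Suc k"] by (auto simp: Suc_diff_Suc)
  qed (simp add: h)
  have range: "h k \<in> {l..u}" if "k \<le> p" for k
    using le_u[OF that] l_le[of "p - k"] that by simp
  have segment: "closed_segment (h k, f (h k)) (h (Suc k), f (h (Suc k))) \<subseteq> neighborhood f \<theta>"
    if k: "k < p" for k
  proof -
    obtain \<alpha> \<beta> where f_eq: "\<And>t. t \<in> {h (Suc k)..h k} \<Longrightarrow> f t = \<alpha> + \<beta> * t"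
      using affine[of "h (Suc k)" "h k"] range[of k] range[of "Suc k"] hS[OF k] k by auto
    show ?thesis
    proof
      fix x assume "x \<in> closed_segment (h k, f (h k)) (h (Suc k), f (h (Suc k)))"
      then obtain v where v: "0 \<le> v" "v \<le> 1"
        "x = ((1 - v) * h k + v * h (Suc k), (1 - v) * f (h k) + v * f (h (Suc k)))"
        by (auto simp: in_segment)
      define t where "t = (1 - v) * h k + v * h (Suc k)"
      have "t \<in> closed_segment (h k) (h (Suc k))" using v by (auto simp: t_def in_segment)
      then have t: "t \<in> {h (Suc k)..h k}" using hS[OF k] by (auto simp: closed_segment_eq_real_ivl)
      have "(1 - v) * f (h k) + v * f (h (Suc k)) = f t"
        using hS[OF k] f_eq[of "h k"] f_eq[of "h (Suc k)"] f_eq[OF t]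
        by (simp add: t_def algebra_simps)
      then have x: "x = (t, f t)" using v by (simp add: t_def)
      have "t \<in> {l..u}" using t range[of k] range[of "Suc k"] k by auto
      then have "0 \<le> f t" "0 \<le> t" using pos lu by auto
      then show "x \<in> neighborhood f \<theta>"
        unfolding x neighborhood_def using \<open>0 \<le> \<theta>\<close> by (auto simp: mult_left_le_one_le algebra_simps)
    qed
  qed
  have "polygon_within f \<theta> l u p"
    unfolding polygon_within_def
  \<comment> \<open>Vertices are numbered from 1 in \<open>polygon_within\<close> but from 0 in
    \<open>h\<close>.\<close>
  proof (rule conjI, simp add: p_def, rule exI[of _ "\<lambda>k. h (k - 1)"],
      rule exI[of _ "\<lambda>k. f (h (k - 1))"], intro conjI ballI)
    fix k assume k: "k \<in> {1..p + 1}"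
    then have "h (k - 1) \<in> {l..u}" by (intro range) auto
    then show "0 \<le> h (k - 1)" "0 \<le> f (h (k - 1))" using lu pos by auto
  next
    fix k assume k: "k \<in> {1..p}"
    then have "k - 1 < p" "Suc (k - 1) = k" by auto
    then show "closed_segment (h (k - 1), f (h (k - 1))) (h (k + 1 - 1), f (h (k + 1 - 1)))
        \<subseteq> neighborhood f \<theta>"
      using segment[of "k - 1"] by simp
  qed (auto simp: h)
  then show ?thesis ..
qed

section \<open>Central pairs for orthogonal subspaces\<close>

definition nonneg_slice :: "(real^'n) set \<Rightarrow> real^'n \<Rightarrow> (real^'n) set" where
  "nonneg_slice W p = {x. x - p \<in> W \<and> (\<forall>i. 0 \<le> x $ i)}"

definition slice_min :: "(real^'n) set \<Rightarrow> real^'n \<Rightarrow> real^'n \<Rightarrow> real" where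
  "slice_min W p q = (INF x\<in>nonneg_slice W p. q \<bullet> x)"

definition coord_max :: "(real^'n) set \<Rightarrow> real^'n \<Rightarrow> real^'n \<Rightarrow> 'n \<Rightarrow> real \<Rightarrow> real" where
  "coord_max W p q i g = Sup {x $ i | x. x \<in> nonneg_slice W p \<and> q \<bullet> x \<le> slice_min W p q + g}"

definition central_pair ::
    "(real^'n) set \<Rightarrow> (real^'n) set \<Rightarrow> real^'n \<Rightarrow> real^'n \<Rightarrow> real \<Rightarrow> real^'n \<Rightarrow> real^'n \<Rightarrow> bool" where
  "central_pair W W' p q \<mu> x s \<longleftrightarrow> x - p \<in> W \<and> s - q \<in> W' \<and>
     (\<forall>i. 0 < x $ i) \<and> (\<forall>i. 0 < s $ i) \<and> (\<forall>i. x $ i * s $ i = \<mu>)"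

text \<open>
  The program pair in self-dual form: the feasible sets are \<open>nonneg_slice W p\<close> and
  \<open>nonneg_slice W' q\<close>, with \<open>W = ker A\<close> and \<open>W' = range A\<^sup>T\<close>, and the two objectives
  are \<open>q \<bullet> x\<close> and \<open>p \<bullet> s\<close>, both to be minimized.
\<close>

locale primal_dual_pair =
  fixes W W' :: "(real^'n) set" and p q :: "real^'n"
  assumes subspace: "subspace W" "subspace W'"
    and orth: "x \<in> W \<Longrightarrow> y \<in> W' \<Longrightarrow> x \<bullet> y = 0"
    and decomp: "\<exists>x\<in>W. \<exists>y\<in>W'. z = x + y"
    and pos: "0 < p $ i" "0 < q $ i"
begin

text \<open>The assumptions are symmetric, so an interpretation transfers every fact on x to
  s.\<close>

lemma dual_pair: "primal_dual_pair W' W q p"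
proof
  show "\<exists>x\<in>W'. \<exists>y\<in>W. z = x + y" for z using decomp[of z] by (metis add.commute)
  show "x \<bullet> y = 0" if "x \<in> W'" "y \<in> W" for x y using orth[OF that(2,1)] by (simp add: inner_commute)
qed (use subspace pos in auto)

text \<open>The W-component of such a vector is orthogonal to itself.\<close>

lemma mem_W'I:
  assumes "\<And>x. x \<in> W \<Longrightarrow> x \<bullet> z = 0"
  shows "z \<in> W'"
proof -
  obtain x y where xy: "x \<in> W" "y \<in> W'" "z = x + y" using decomp by blast
  then have "x \<bullet> x = 0" using assms[of x] orth[of x y] by (simp add: inner_add_right)
  then show ?thesis using xy by simp
qed

text \<open>Expansion of \<open>(x - p) \<bullet> (s - q) = 0\<close>. It makes the duality gap a
  sum of the two objectives up to a constant, the source of all duality facts below.\<close>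

lemma inner_eq:
  assumes "x - p \<in> W" "s - q \<in> W'"
  shows "x \<bullet> s = q \<bullet> x + p \<bullet> s - p \<bullet> q"
  using orth[OF assms] by (simp add: inner_diff_left inner_diff_right inner_commute)

section \<open>Compact sublevel sets, existence and uniqueness of central pairs\<close>

lemma nonneg_sliceD:
  assumes "x \<in> nonneg_slice W p"
  shows "x - p \<in> W" "0 \<le> x $ i"
  using assms by (auto simp: nonneg_slice_def)

lemma p_in: "p \<in> nonneg_slice W p"
  using pos subspace_0[OF subspace(1)] by (auto simp: nonneg_slice_def less_imp_le)

text \<open>Positivity of q, the strictly feasible point of the other program, is what bounds the
  sublevel sets.\<close>

lemma coord_le: "x \<in> nonneg_slice W p \<Longrightarrow> x $ i \<le> (q \<bullet> x) / q $ i"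
proof -
  assume x: "x \<in> nonneg_slice W p"
  have "q $ i * x $ i \<le> (\<Sum>i\<in>UNIV. q $ i * x $ i)"
    using pos nonneg_sliceD[OF x] by (intro member_le_sum) (auto simp: less_imp_le)
  then show ?thesis using pos(2)[of i] by (simp add: inner_vec_def field_simps)
qed

lemma inner_nonneg: "x \<in> nonneg_slice W p \<Longrightarrow> 0 \<le> q \<bullet> x"
  unfolding inner_vec_def using pos nonneg_sliceD
  by (intro sum_nonneg) (auto simp: less_imp_le)

lemma closed_nonneg_slice: "closed (nonneg_slice W p)"
proof -
  have "nonneg_slice W p = (\<lambda>x. x - p) -` W \<inter> (\<Inter>i. {x. 0 \<le> x $ i})"
    by (auto simp: nonneg_slice_def)
  also have "closed \<dots>"
    by (intro closed_Int closed_INT ballI closed_vimage closed_subspace subspace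
        closed_Collect_le continuous_intros)
  finally show ?thesis .
qed

lemma compact_sublevel: "compact {x \<in> nonneg_slice W p. q \<bullet> x \<le> M}"
  unfolding compact_eq_bounded_closed
proof
  define R where "R = (\<Sum>i\<in>UNIV. \<bar>M / q $ i\<bar>)"
  have "norm x \<le> R" if "x \<in> {x \<in> nonneg_slice W p. q \<bullet> x \<le> M}" for x
  proof -
    have "norm x \<le> (\<Sum>i\<in>UNIV. \<bar>x $ i\<bar>)" by (rule norm_le_l1_cart)
    also have "\<dots> \<le> R"
      unfolding R_def
    proof (rule sum_mono)
      fix i
      have "x $ i \<le> (q \<bullet> x) / q $ i" "0 \<le> x $ i" using that coord_le nonneg_sliceD by auto
      moreover have "(q \<bullet> x) / q $ i \<le> M / q $ i"
        using that pos(2)[of i] by (intro divide_right_mono) auto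
      ultimately show "\<bar>x $ i\<bar> \<le> \<bar>M / q $ i\<bar>" by linarith
    qed
    finally show ?thesis .
  qed
  then show "bounded {x \<in> nonneg_slice W p. q \<bullet> x \<le> M}" unfolding bounded_iff by blast
  have "{x \<in> nonneg_slice W p. q \<bullet> x \<le> M} = nonneg_slice W p \<inter> {x. q \<bullet> x \<le> M}" by auto
  then show "closed {x \<in> nonneg_slice W p. q \<bullet> x \<le> M}"
    by (simp add: closed_Int closed_nonneg_slice closed_halfspace_le)
qed

text \<open>
  The barrier \<open>q \<bullet> x - \<mu> * (\<Sum>i. ln (x $ i))\<close> is replaced by \<open>exp\<close> of its
  negative multiple, which is continuous up to the boundary.
\<close>

lemma central_pair_exists:
  assumes \<mu>: "0 < \<mu>"
  shows "\<exists>x s. central_pair W W' p q \<mu> x s"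
proof -
  define \<psi> where "\<psi> x = exp (- (q \<bullet> x / \<mu>)) * (\<Prod>i\<in>UNIV. x $ i)" for x :: "real^'n"
  have \<psi>_p: "0 < \<psi> p" unfolding \<psi>_def using pos by (intro mult_pos_pos prod_pos) auto
  define C where "C = (\<Prod>i\<in>UNIV. \<mu> / q $ i)"
  have C: "0 < C" unfolding C_def using pos \<mu> by (intro prod_pos) auto
  \<comment> \<open>With \<open>t = q \<bullet> x / \<mu>\<close> each coordinate is at most
    \<open>\<mu> / q $ i * t\<close>, so \<psi> is at most C times a power of t over
    \<open>exp t\<close>. This decay yields a maximum although the slice may be unbounded.\<close>
  have \<psi>_le: "\<psi> x \<le> C * ((q \<bullet> x / \<mu>) ^ CARD('n) / exp (q \<bullet> x / \<mu>))" if x: "x \<in> nonneg_slice W p" for x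
  proof -
    have "(\<Prod>i\<in>UNIV. x $ i) \<le> (\<Prod>i\<in>UNIV. \<mu> / q $ i * (q \<bullet> x / \<mu>))"
      using coord_le[OF x] nonneg_sliceD(2)[OF x] \<mu> by (intro prod_mono) auto
    also have "\<dots> = C * (q \<bullet> x / \<mu>) ^ CARD('n)" by (simp only: prod.distrib prod_constant C_def)
    finally show ?thesis by (simp add: \<psi>_def exp_minus field_simps)
  qed
  have "((\<lambda>t. t ^ CARD('n) / exp t) \<longlongrightarrow> 0) (at_top :: real filter)"
    by (rule tendsto_power_div_exp_0)
  then have "\<forall>\<^sub>F t :: real in at_top. t ^ CARD('n) / exp t < \<psi> p / C"
    using \<psi>_p C by (intro order_tendstoD) auto
  then obtain M0 where M0: "\<And>t :: real. t \<ge> M0 \<Longrightarrow> t ^ CARD('n) / exp t < \<psi> p / C"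
    by (auto simp: eventually_at_top_linorder)
  \<comment> \<open>Beyond \<open>\<mu> * M0\<close> the bound is below \<open>\<psi> p\<close>; the
    term \<open>q \<bullet> p\<close> puts p itself into the compact set.\<close>
  define M where "M = max (q \<bullet> p) (\<mu> * M0)"
  let ?K = "{x \<in> nonneg_slice W p. q \<bullet> x \<le> M}"
  have "continuous_on ?K \<psi>" unfolding \<psi>_def using \<mu> by (intro continuous_intros) auto
  then obtain x where x: "x \<in> ?K" and x_max: "\<And>y. y \<in> ?K \<Longrightarrow> \<psi> y \<le> \<psi> x"
    using continuous_attains_sup[OF compact_sublevel, of M \<psi>] p_in by (fastforce simp: M_def)
  have \<psi>x: "\<psi> p \<le> \<psi> x" using x_max[of p] p_in by (simp add: M_def)
  have max: "\<psi> y \<le> \<psi> x" if y: "y \<in> nonneg_slice W p" for y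
  proof (cases "q \<bullet> y \<le> M")
    case False
    then have "M0 \<le> q \<bullet> y / \<mu>" using \<mu> by (simp add: M_def field_simps)
    then have "C * ((q \<bullet> y / \<mu>) ^ CARD('n) / exp (q \<bullet> y / \<mu>)) < C * (\<psi> p / C)"
      using M0 C by (intro mult_strict_left_mono) auto
    then show ?thesis using \<psi>_le[OF y] \<psi>x C by simp
  qed (use x_max y in auto)
  have xW: "x - p \<in> W" using x nonneg_sliceD by auto
  have x_pos: "0 < x $ i" for i
  proof -
    have "(\<Prod>i\<in>UNIV. x $ i) \<noteq> 0"
    proof
      assume "(\<Prod>i\<in>UNIV. x $ i) = 0"
      then have "\<psi> x = 0" by (simp only: \<psi>_def mult_zero_right)
      then show False using \<psi>x \<psi>_p by simp
    qed
    then have "x $ i \<noteq> 0" by auto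
    moreover have "0 \<le> x $ i" using x nonneg_sliceD by auto
    ultimately show ?thesis by simp
  qed
  define s where "s = (\<chi> i. \<mu> / x $ i)"
  have "s - q \<in> W'"
  proof (rule mem_W'I)
    fix w assume w: "w \<in> W"
    define F where "F t = \<psi> (x + t *\<^sub>R w)" for t
    \<comment> \<open>The logarithmic derivative of \<psi> along w. Its vanishing at the maximizer
      says \<open>w \<bullet> s = w \<bullet> q\<close>; both signs of t are allowed because x is
      positive.\<close>
    define d where "d = - (q \<bullet> w / \<mu>) + (\<Sum>i\<in>UNIV. w $ i / x $ i)"
    have "((\<lambda>t. \<Prod>i\<in>UNIV. x $ i + t * w $ i) has_field_derivative
        (\<Prod>i\<in>UNIV. x $ i + 0 * w $ i) * (\<Sum>i\<in>UNIV. w $ i / (x $ i + 0 * w $ i))) (at 0)"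
      using x_pos by (intro has_field_derivative_prod') (auto intro!: derivative_eq_intros simp: less_imp_neq[symmetric])
    then have "((\<lambda>t. exp (- ((q \<bullet> x + t * (q \<bullet> w)) / \<mu>)) * (\<Prod>i\<in>UNIV. x $ i + t * w $ i))
        has_field_derivative \<psi> x * d) (at 0)"
      using \<mu> by (auto intro!: derivative_eq_intros simp: \<psi>_def d_def algebra_simps)
    then have der: "(F has_field_derivative \<psi> x * d) (at 0)"
      by (simp add: F_def[abs_def] \<psi>_def inner_add_right)
    have "\<forall>\<^sub>F t in at 0. \<forall>i. 0 < (x + t *\<^sub>R w) $ i"
    proof (rule eventually_all_finite)
      fix i
      have "((\<lambda>t. (x + t *\<^sub>R w) $ i) \<longlongrightarrow> (x + 0 *\<^sub>R w) $ i) (at (0 :: real))"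
        by (intro tendsto_intros)
      then show "\<forall>\<^sub>F t in at 0. 0 < (x + t *\<^sub>R w) $ i"
        using x_pos[of i] by (intro order_tendstoD) auto
    qed
    then obtain \<delta> where \<delta>: "0 < \<delta>"
      "\<And>t. t \<noteq> 0 \<Longrightarrow> \<bar>t\<bar> < \<delta> \<Longrightarrow> (\<forall>i. 0 < (x + t *\<^sub>R w) $ i)"
      unfolding eventually_at by (auto simp: dist_real_def)
    have "F t \<le> F 0" if "\<bar>0 - t\<bar> < \<delta>" for t
    proof (cases "t = 0")
      case False
      have "(x - p) + t *\<^sub>R w \<in> W"
        by (intro subspace_add subspace_scale subspace xW w)
      then have "x + t *\<^sub>R w \<in> nonneg_slice W p"
        using \<delta>(2)[of t] False that
        by (auto simp: nonneg_slice_def algebra_simps less_imp_le)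
      then show ?thesis using max by (simp add: F_def)
    qed simp
    then have "\<psi> x * d = 0" using DERIV_local_max[OF der \<delta>(1)] by blast
    then have "d = 0" using \<psi>x \<psi>_p by auto
    moreover have "w \<bullet> s = \<mu> * (\<Sum>i\<in>UNIV. w $ i / x $ i)"
      by (simp add: inner_vec_def s_def sum_distrib_left mult_ac)
    ultimately show "w \<bullet> (s - q) = 0"
      using \<mu> by (simp add: d_def inner_diff_right inner_commute field_simps)
  qed
  moreover have "x $ i * s $ i = \<mu>" "0 < s $ i" for i
    using x_pos[of i] \<mu> by (auto simp: s_def)
  ultimately show ?thesis using xW x_pos unfolding central_pair_def by blast
qed

text \<open>As \<open>s $ i = \<mu> / x $ i\<close>, the coordinates of x and s move in opposite
  directions: all terms of \<open>(x - x') \<bullet> (s - s')\<close> are nonpositive, while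
  orthogonality makes their sum 0.\<close>

lemma central_pair_unique:
  assumes "0 < \<mu>" and c: "central_pair W W' p q \<mu> x s" "central_pair W W' p q \<mu> x' s'"
  shows "x = x' \<and> s = s'"
proof -
  have "x - x' \<in> W" "s - s' \<in> W'"
    using c subspace_diff[OF subspace(1), of "x - p" "x' - p"]
      subspace_diff[OF subspace(2), of "s - q" "s' - q"] by (auto simp: central_pair_def)
  then have "(\<Sum>i\<in>UNIV. - ((x $ i - x' $ i) * (s $ i - s' $ i))) = 0"
    using orth[of "x - x'" "s - s'"] by (simp add: inner_vec_def sum_negf)
  moreover have nonneg: "- ((x $ i - x' $ i) * (s $ i - s' $ i)) = (x $ i - x' $ i)\<^sup>2 * \<mu> / (x $ i * x' $ i)"
    and pos: "0 < x $ i" "0 < x' $ i" and s: "s $ i = \<mu> / x $ i" "s' $ i = \<mu> / x' $ i" for i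
  proof -
    show p: "0 < x $ i" "0 < x' $ i" using c by (auto simp: central_pair_def)
    show s: "s $ i = \<mu> / x $ i" "s' $ i = \<mu> / x' $ i"
    proof -
      have "x $ i * s $ i = \<mu>" "x' $ i * s' $ i = \<mu>" using c by (auto simp: central_pair_def)
      then show "s $ i = \<mu> / x $ i" "s' $ i = \<mu> / x' $ i" using p by (auto simp: field_simps)
    qed
    show "- ((x $ i - x' $ i) * (s $ i - s' $ i)) = (x $ i - x' $ i)\<^sup>2 * \<mu> / (x $ i * x' $ i)"
      using p unfolding s by (simp add: field_simps power2_eq_square)
  qed
  ultimately have "\<forall>i\<in>UNIV. (x $ i - x' $ i)\<^sup>2 * \<mu> / (x $ i * x' $ i) = 0"
    using pos assms(1) by (subst (asm) sum_nonneg_eq_0_iff) (auto simp: less_imp_le)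
  then have "x $ i = x' $ i" for i
    using pos[of i] assms(1) by auto
  then show ?thesis using s by (simp add: vec_eq_iff)
qed

section \<open>Duality gap, strong duality and the coordinate maxima\<close>

lemma central_pair_nonneg_slice:
  assumes "central_pair W W' p q \<mu> x s"
  shows "x \<in> nonneg_slice W p" "s \<in> nonneg_slice W' q"
  using assms by (auto simp: central_pair_def nonneg_slice_def less_imp_le)

lemma central_pair_gap:
  assumes "central_pair W W' p q \<mu> x s"
  shows "q \<bullet> x + p \<bullet> s = p \<bullet> q + real CARD('n) * \<mu>"
proof -
  have "x \<bullet> s = real CARD('n) * \<mu>"
    using assms by (simp add: central_pair_def inner_vec_def)
  then show ?thesis using inner_eq[of x s] assms by (simp add: central_pair_def)
qed

lemma slice_min_le: "x \<in> nonneg_slice W p \<Longrightarrow> slice_min W p q \<le> q \<bullet> x"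
  unfolding slice_min_def by (rule cINF_lower) (auto intro!: bdd_belowI2 inner_nonneg)

lemma inner_nonneg_slices: "x \<in> nonneg_slice W p \<Longrightarrow> s \<in> nonneg_slice W' q \<Longrightarrow> 0 \<le> x \<bullet> s"
  by (auto simp: nonneg_slice_def inner_vec_def intro!: sum_nonneg)

lemma weak_duality:
  "x \<in> nonneg_slice W p \<Longrightarrow> s \<in> nonneg_slice W' q \<Longrightarrow> p \<bullet> q \<le> q \<bullet> x + p \<bullet> s"
  using inner_nonneg_slices[of x s] inner_eq[of x s] by (auto simp: nonneg_slice_def)

text \<open>The nontrivial inequality comes from the central pair with parameter e / n, whose gap is
  exactly e.\<close>

lemma strong_duality: "slice_min W p q + slice_min W' q p = p \<bullet> q"
proof (rule antisym)
  interpret dual: primal_dual_pair W' W q p by (rule dual_pair)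
  show "slice_min W p q + slice_min W' q p \<le> p \<bullet> q"
  proof (rule field_le_epsilon)
    fix e :: real assume e: "0 < e"
    obtain x s where c: "central_pair W W' p q (e / real CARD('n)) x s"
      using central_pair_exists[of "e / real CARD('n)"] e by auto
    show "slice_min W p q + slice_min W' q p \<le> p \<bullet> q + e"
      using slice_min_le dual.slice_min_le central_pair_nonneg_slice[OF c] central_pair_gap[OF c]
      by fastforce
  qed
  have "p \<bullet> q - p \<bullet> s \<le> slice_min W p q" if "s \<in> nonneg_slice W' q" for s
    unfolding slice_min_def using weak_duality[OF _ that] p_in
    by (intro cINF_greatest) (auto simp: algebra_simps)
  then have "p \<bullet> q - slice_min W p q \<le> slice_min W' q p"
    unfolding slice_min_def[of W'] using dual.p_in
    by (intro cINF_greatest) (force simp: algebra_simps)+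
  then show "p \<bullet> q \<le> slice_min W p q + slice_min W' q p" by simp
qed

lemma slice_min_attained: "\<exists>x\<in>nonneg_slice W p. q \<bullet> x = slice_min W p q"
proof -
  let ?K = "{x \<in> nonneg_slice W p. q \<bullet> x \<le> q \<bullet> p}"
  have "continuous_on ?K ((\<bullet>) q)" by (intro continuous_intros)
  then obtain x where x: "x \<in> ?K" "\<And>y. y \<in> ?K \<Longrightarrow> q \<bullet> x \<le> q \<bullet> y"
    using continuous_attains_inf[OF compact_sublevel, of "q \<bullet> p" "(\<bullet>) q"] p_in by fastforce
  have "q \<bullet> x \<le> q \<bullet> y" if "y \<in> nonneg_slice W p" for y
    using x that by (cases "q \<bullet> y \<le> q \<bullet> p") auto
  then have "q \<bullet> x \<le> slice_min W p q"
    unfolding slice_min_def using p_in by (intro cINF_greatest) auto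
  then show ?thesis using x slice_min_le[of x] by force
qed

lemma coord_max_attained:
  assumes "0 \<le> g"
  shows "\<exists>x\<in>nonneg_slice W p. q \<bullet> x \<le> slice_min W p q + g \<and> x $ i = coord_max W p q i g"
    and "x \<in> nonneg_slice W p \<Longrightarrow> q \<bullet> x \<le> slice_min W p q + g \<Longrightarrow> x $ i \<le> coord_max W p q i g"
proof -
  let ?K = "{x \<in> nonneg_slice W p. q \<bullet> x \<le> slice_min W p q + g}"
  have eq: "{x $ i | x. x \<in> nonneg_slice W p \<and> q \<bullet> x \<le> slice_min W p q + g} = (\<lambda>x. x $ i) ` ?K"
    by blast
  have "continuous_on ?K (\<lambda>x. x $ i)" by (intro continuous_intros)
  moreover have "?K \<noteq> {}" using slice_min_attained assms by force
  ultimately obtain y where y: "y \<in> ?K" "\<And>x. x \<in> ?K \<Longrightarrow> x $ i \<le> y $ i"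
    using continuous_attains_sup[OF compact_sublevel, of _ "\<lambda>x. x $ i"] by blast
  then have "coord_max W p q i g = y $ i"
    unfolding coord_max_def eq by (intro cSup_eq_maximum) auto
  then show "\<exists>x\<in>nonneg_slice W p. q \<bullet> x \<le> slice_min W p q + g \<and> x $ i = coord_max W p q i g"
    and "x \<in> nonneg_slice W p \<Longrightarrow> q \<bullet> x \<le> slice_min W p q + g \<Longrightarrow> x $ i \<le> coord_max W p q i g"
    using y by auto
qed

text \<open>The total gap is n\<mu> and s is no better than the dual optimum, so x is within n\<mu>
  of the primal optimum and competes in the maximum.\<close>

lemma central_pair_le_coord_max:
  assumes "0 < \<mu>" and c: "central_pair W W' p q \<mu> x s"
  shows "x $ i \<le> coord_max W p q i (real CARD('n) * \<mu>)"
proof (rule coord_max_attained)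
  interpret dual: primal_dual_pair W' W q p by (rule dual_pair)
  show "q \<bullet> x \<le> slice_min W p q + real CARD('n) * \<mu>"
    using dual.slice_min_le[OF central_pair_nonneg_slice(2)[OF c]] strong_duality
      central_pair_gap[OF c] by linarith
qed (use assms central_pair_nonneg_slice in auto)

text \<open>For a maximizer y, \<open>y $ i * s $ i \<le> y \<bullet> s \<le> 2n\<mu>\<close>: one
  n\<mu> is the slack allowed to y, the other the gap of the central pair. Replacing \<mu> by
  \<open>x $ i * s $ i\<close> and cancelling \<open>s $ i\<close> gives the bound.\<close>

lemma coord_max_le_central_pair:
  assumes "0 < \<mu>" and c: "central_pair W W' p q \<mu> x s"
  shows "coord_max W p q i (real CARD('n) * \<mu>) \<le> 2 * real CARD('n) * x $ i"
proof -
  have "0 \<le> real CARD('n) * \<mu>" using assms by simp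
  then obtain y where y: "y \<in> nonneg_slice W p" "q \<bullet> y \<le> slice_min W p q + real CARD('n) * \<mu>"
    "y $ i = coord_max W p q i (real CARD('n) * \<mu>)"
    using coord_max_attained(1)[of "real CARD('n) * \<mu>" i] by auto
  have s: "s - q \<in> W'" "0 < x $ i" "0 < s $ i" "x $ i * s $ i = \<mu>" using c by (auto simp: central_pair_def)
  have "y $ i * s $ i \<le> (\<Sum>i\<in>UNIV. y $ i * s $ i)"
    using y(1) c by (intro member_le_sum) (auto simp: nonneg_slice_def central_pair_def less_imp_le)
  also have "\<dots> = y \<bullet> s" by (simp add: inner_vec_def)
  also have "\<dots> = q \<bullet> y + p \<bullet> s - p \<bullet> q" using y(1) s by (intro inner_eq) (auto simp: nonneg_slice_def)
  also have "\<dots> \<le> 2 * (real CARD('n) * \<mu>)"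
    using y(2) slice_min_le[OF central_pair_nonneg_slice(1)[OF c]] central_pair_gap[OF c] by linarith
  also have "\<dots> = (2 * real CARD('n) * x $ i) * s $ i" by (simp add: s(4)[symmetric])
  finally show ?thesis using s(3) y(3) by simp
qed

text \<open>Parametric linear programming: with g as an additional variable, the polytope of pairs
  (x, g) projects onto a planar polytope whose upper boundary is the maximum, which is therefore
  piecewise affine.\<close>

lemma coord_max_polygon:
  assumes "0 \<le> l" "l < u" "0 \<le> \<theta>"
  shows "\<exists>p'. polygon_within (coord_max W p q i) \<theta> l u p'"
proof -
  let ?f = "coord_max W p q i"
  let ?v = "slice_min W p q"
  define R where "R = {y :: (real^'n) \<times> real. fst y \<in> nonneg_slice W p \<and> q \<bullet> fst y \<le> ?v + snd y \<and>
    l \<le> snd y \<and> snd y \<le> u}"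
  have "bounded R"
  proof (rule bounded_subset)
    show "bounded ({x \<in> nonneg_slice W p. q \<bullet> x \<le> ?v + u} \<times> {l..u})"
      by (intro bounded_Times compact_imp_bounded compact_sublevel) auto
  qed (auto simp: R_def)
  moreover have "polyhedron R"
  proof -
    have "affine {y :: (real^'n) \<times> real. fst y - p \<in> W}"
      unfolding affine_def
    proof (intro ballI allI impI)
      fix x y :: "(real^'n) \<times> real" and a b :: real
      assume *: "x \<in> {y. fst y - p \<in> W}" "y \<in> {y. fst y - p \<in> W}" "a + b = 1"
      then have "a *\<^sub>R (fst x - p) + b *\<^sub>R (fst y - p) \<in> W"
        by (intro subspace_add subspace_scale subspace) auto
      moreover have "a *\<^sub>R p + b *\<^sub>R p = p" using *(3) by (metis scaleR_add_left scaleR_one)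
      ultimately show "a *\<^sub>R x + b *\<^sub>R y \<in> {y. fst y - p \<in> W}"
        by (simp add: algebra_simps)
    qed
    then have aff: "polyhedron {y :: (real^'n) \<times> real. fst y - p \<in> W}"
      by (rule affine_imp_polyhedron)
    have "polyhedron ({y :: (real^'n) \<times> real. fst y - p \<in> W} \<inter>
        (\<Inter>j\<in>UNIV. {y. (axis j 1, 0) \<bullet> y \<ge> 0}) \<inter> {y. (q, -1) \<bullet> y \<le> ?v} \<inter>
        {y. (0, 1) \<bullet> y \<ge> l} \<inter> {y. (0, 1) \<bullet> y \<le> u})"
      by (intro polyhedron_Int polyhedron_Inter aff)
        (auto intro: polyhedron_halfspace_le polyhedron_halfspace_ge)
    also have "\<dots> = R"
      by (auto simp: R_def nonneg_slice_def inner_prod_def inner_axis inner_commute[of "axis _ _"] algebra_simps)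
    finally show ?thesis .
  qed
  ultimately have "polytope R" by (simp add: polytope_eq_bounded_polyhedron)
  moreover have "linear (\<lambda>y :: (real^'n) \<times> real. (snd y, fst y $ i))"
    by (intro linearI) auto
  ultimately have P: "polytope ((\<lambda>y. (snd y, fst y $ i)) ` R)" by (rule polytope_linear_image[rotated])
  have "(t, ?f t) \<in> (\<lambda>y. (snd y, fst y $ i)) ` R \<and>
      (\<forall>z. (t, z) \<in> (\<lambda>y. (snd y, fst y $ i)) ` R \<longrightarrow> z \<le> ?f t)" if t: "t \<in> {l..u}" for t
  proof -
    have t0: "0 \<le> t" using t assms by auto
    obtain x where x: "x \<in> nonneg_slice W p" "q \<bullet> x \<le> ?v + t" "x $ i = ?f t"
      using coord_max_attained(1)[OF t0, of i] by blast
    have "(x, t) \<in> R" using x t by (auto simp: R_def)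
    then have "(t, ?f t) \<in> (\<lambda>y. (snd y, fst y $ i)) ` R" using x(3) by force
    then show ?thesis using coord_max_attained(2)[OF t0, of _ i] by (auto simp: R_def)
  qed
  from polytope_upper_boundary[OF P this] obtain F where F: "finite F"
    "\<And>t. t \<in> {l..u} \<Longrightarrow> \<exists>(\<alpha>, \<beta>)\<in>F. ?f t = \<alpha> + \<beta> * t"
    "\<And>t \<alpha> \<beta>. t \<in> {l..u} \<Longrightarrow> (\<alpha>, \<beta>) \<in> F \<Longrightarrow> ?f t \<le> \<alpha> + \<beta> * t"
    by metis
  from minimum_of_affine_breakpoints[OF F(1) assms(2) F(2,3)]
  obtain D where D: "finite D" "D \<subseteq> {l<..<u}"
    "\<And>a b. l \<le> a \<Longrightarrow> a < b \<Longrightarrow> b \<le> u \<Longrightarrow> D \<inter> {a<..<b} = {} \<Longrightarrow>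
      \<exists>\<alpha> \<beta>. \<forall>t\<in>{a..b}. ?f t = \<alpha> + \<beta> * t"
    by metis
  have "0 \<le> ?f t" if "t \<in> {l..u}" for t
  proof -
    have "0 \<le> t" using that assms by auto
    from coord_max_attained(1)[OF this, of i] show ?thesis using nonneg_sliceD(2) by metis
  qed
  from polygon_within_piecewise_affine[OF D(1,2) assms this D(3)] show ?thesis .
qed

section \<open>Cluster points of the path and its convergence as \<mu> tends to 0\<close>

lemma central_pair_cross:
  assumes \<mu>: "0 < \<mu>" and c: "central_pair W W' p q \<mu> x s"
    and "x' - p \<in> W" "s' - q \<in> W'" "x' \<bullet> s' = 0"
  shows "(\<Sum>i\<in>UNIV. x' $ i / x $ i + s' $ i / s $ i) = real CARD('n)"
proof -
  have xs: "x - p \<in> W" "s - q \<in> W'" using c by (auto simp: central_pair_def)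
  \<comment> \<open>By \<open>inner_eq\<close> a gap is a sum of two objectives, so mixed and
    unmixed gaps have the same total.\<close>
  have "x' \<bullet> s + x \<bullet> s' = x' \<bullet> s' + x \<bullet> s"
    using inner_eq[OF assms(3) xs(2)] inner_eq[OF xs(1) assms(4)] inner_eq[OF assms(3,4)]
      inner_eq[OF xs] by linarith
  also have "\<dots> = real CARD('n) * \<mu>"
    using c assms(5) by (simp add: central_pair_def inner_vec_def)
  finally have "(\<Sum>i\<in>UNIV. x' $ i * s $ i + x $ i * s' $ i) = real CARD('n) * \<mu>"
    by (simp add: inner_vec_def sum.distrib)
  moreover have "x' $ i * s $ i + x $ i * s' $ i = \<mu> * (x' $ i / x $ i + s' $ i / s $ i)" for i
  proof -
    have *: "0 < x $ i" "0 < s $ i" "\<mu> = x $ i * s $ i" using c by (auto simp: central_pair_def)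
    show ?thesis unfolding *(3) using *(1,2) by (simp add: field_simps)
  qed
  ultimately have "\<mu> * (\<Sum>i\<in>UNIV. x' $ i / x $ i + s' $ i / s $ i) = \<mu> * real CARD('n)"
    by (simp add: sum_distrib_left mult.commute)
  then show ?thesis using \<mu> by simp
qed

definition path_cluster where
  "path_cluster x s \<longleftrightarrow> (\<exists>\<nu> X S. (\<forall>k :: nat. 0 < \<nu> k \<and> central_pair W W' p q (\<nu> k) (X k) (S k)) \<and>
     \<nu> \<longlonglongrightarrow> 0 \<and> X \<longlonglongrightarrow> x \<and> S \<longlonglongrightarrow> s)"

lemma path_cluster_optimal:
  assumes "path_cluster x s"
  shows "x - p \<in> W" "s - q \<in> W'" "0 \<le> x $ i" "0 \<le> s $ i" "x \<bullet> s = 0"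
proof -
  interpret dual: primal_dual_pair W' W q p by (rule dual_pair)
  obtain \<nu> X S where c: "\<And>k. 0 < \<nu> k" "\<And>k. central_pair W W' p q (\<nu> k) (X k) (S k)"
    and lim: "\<nu> \<longlonglongrightarrow> 0" "X \<longlonglongrightarrow> x" "S \<longlonglongrightarrow> s"
    using assms unfolding path_cluster_def by blast
  have "x \<in> nonneg_slice W p" "s \<in> nonneg_slice W' q"
    using closed_sequentially[OF closed_nonneg_slice _ lim(2)]
      closed_sequentially[OF dual.closed_nonneg_slice _ lim(3)] central_pair_nonneg_slice[OF c(2)]
    by auto
  then show "x - p \<in> W" "s - q \<in> W'" "0 \<le> x $ i" "0 \<le> s $ i" by (auto simp: nonneg_slice_def)
  have "X k \<bullet> S k = real CARD('n) * \<nu> k" for k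
    using c(2)[of k] by (simp add: central_pair_def inner_vec_def)
  then have "(\<lambda>k. real CARD('n) * \<nu> k) \<longlonglongrightarrow> x \<bullet> s"
    using tendsto_inner[OF lim(2,3)] by simp
  moreover have "(\<lambda>k. real CARD('n) * \<nu> k) \<longlonglongrightarrow> real CARD('n) * 0" by (intro tendsto_intros lim)
  ultimately have "x \<bullet> s = real CARD('n) * 0" by (rule LIMSEQ_unique)
  then show "x \<bullet> s = 0" by simp
qed

text \<open>The cross identity gives \<open>x' $ i \<le> n * X k $ i\<close> at every central pair,
  hence also in the limit. So x' vanishes where x does, likewise for s, and the identity survives
  vanishing denominators.\<close>

lemma path_cluster_cross:
  assumes "path_cluster x s" "path_cluster x' s'"
  shows "(\<Sum>i\<in>UNIV. x' $ i / x $ i + s' $ i / s $ i) = real CARD('n)"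
    and "x $ i = 0 \<Longrightarrow> x' $ i = 0" and "s $ i = 0 \<Longrightarrow> s' $ i = 0"
proof -
  note opt' = path_cluster_optimal[OF assms(2)]
  obtain \<nu> X S where c: "\<And>k. 0 < \<nu> k" "\<And>k. central_pair W W' p q (\<nu> k) (X k) (S k)"
    and lim: "\<nu> \<longlonglongrightarrow> 0" "X \<longlonglongrightarrow> x" "S \<longlonglongrightarrow> s"
    using assms unfolding path_cluster_def by blast
  have eq: "(\<Sum>i\<in>UNIV. x' $ i / X k $ i + s' $ i / S k $ i) = real CARD('n)" for k
    by (rule central_pair_cross[OF c opt'(1,2,5)])
  have pos: "0 < X k $ i" "0 < S k $ i" for k i using c(2)[of k] by (auto simp: central_pair_def)
  have nn: "0 \<le> x' $ i / X k $ i" "0 \<le> s' $ i / S k $ i" for k i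
    using opt'(3,4)[of i] pos[of k i] by simp_all
  have le: "x' $ i / X k $ i + s' $ i / S k $ i \<le> real CARD('n)" for k i
    using member_le_sum[of i UNIV "\<lambda>i. x' $ i / X k $ i + s' $ i / S k $ i"] nn eq[of k] by simp
  have div_le: "x' $ i / X k $ i \<le> real CARD('n)" "s' $ i / S k $ i \<le> real CARD('n)" for k i
    using le[of i k] nn(1)[where i = i and k = k] nn(2)[where i = i and k = k] by linarith+
  have bound: "x' $ i \<le> real CARD('n) * X k $ i" "s' $ i \<le> real CARD('n) * S k $ i" for k i
    using div_le[where i = i and k = k] pos[of k i] by (simp_all add: pos_divide_le_eq)
  have lim_n: "(\<lambda>k. real CARD('n) * X k $ i) \<longlonglongrightarrow> real CARD('n) * x $ i"
    "(\<lambda>k. real CARD('n) * S k $ i) \<longlonglongrightarrow> real CARD('n) * s $ i" for i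
    by (rule tendsto_mult_left tendsto_vec_nth lim)+
  have le_lim: "x' $ i \<le> real CARD('n) * x $ i" "s' $ i \<le> real CARD('n) * s $ i" for i
    using LIMSEQ_le_const[OF lim_n(1)[of i], of "x' $ i"] LIMSEQ_le_const[OF lim_n(2)[of i], of "s' $ i"]
      bound[of i] by simp_all
  have zero: "x' $ i = 0" if "x $ i = 0" for i
    using le_lim(1)[of i] opt'(3)[of i] that by simp
  have zero': "s' $ i = 0" if "s $ i = 0" for i
    using le_lim(2)[of i] opt'(4)[of i] that by simp
  \<comment> \<open>If \<open>x $ i = 0\<close>, the quotients are constantly 0, which agrees with
    \<open>0 / 0 = 0\<close>.\<close>
  have "(\<lambda>k. x' $ i / X k $ i) \<longlonglongrightarrow> x' $ i / x $ i" for i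
    using zero[of i] by (cases "x $ i = 0") (auto intro!: tendsto_divide tendsto_const tendsto_vec_nth lim)
  moreover have "(\<lambda>k. s' $ i / S k $ i) \<longlonglongrightarrow> s' $ i / s $ i" for i
    using zero'[of i] by (cases "s $ i = 0") (auto intro!: tendsto_divide tendsto_const tendsto_vec_nth lim)
  ultimately have "(\<lambda>k. \<Sum>i\<in>UNIV. x' $ i / X k $ i + s' $ i / S k $ i)
      \<longlonglongrightarrow> (\<Sum>i\<in>UNIV. x' $ i / x $ i + s' $ i / s $ i)"
    by (intro tendsto_sum tendsto_add)
  then show "(\<Sum>i\<in>UNIV. x' $ i / x $ i + s' $ i / s $ i) = real CARD('n)"
    unfolding eq by (simp add: LIMSEQ_const_iff)
  show "x $ i = 0 \<Longrightarrow> x' $ i = 0" "s $ i = 0 \<Longrightarrow> s' $ i = 0"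
    using zero zero' by simp_all
qed

text \<open>
  The ratios of two cluster points sum to \<open>n\<close>, and so do their reciprocals; as there are exactly
  \<open>n\<close> nonzero ratios, the equality case \<open>r + 1 / r = 2\<close> of AM-GM applies to each of them.
  A ratio \<open>0 / 0\<close> is \<open>0\<close> here.
\<close>

lemma path_cluster_unique:
  assumes c: "path_cluster x s" "path_cluster x' s'"
  shows "x = x' \<and> s = s'"
proof -
  \<comment> \<open>This is r + 1 / r - 2 for r = b / a; \<open>a / a\<close> replaces 1 so that a =
    b = 0 contributes 0.\<close>
  define e where "e a b = b / a + a / b - 2 * (a / a)" for a b :: real
  have e: "0 \<le> e a b \<and> (e a b = 0 \<longrightarrow> a = b)"
    if "0 \<le> a" "0 \<le> b" "a = 0 \<longleftrightarrow> b = 0" for a b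
  proof (cases "a = 0")
    case False
    then have "0 < a" "0 < b" using that by auto
    then have "e a b = (a - b)\<^sup>2 / (a * b)" "0 < a * b"
      by (simp_all add: e_def field_simps power2_eq_square)
    then show ?thesis by auto
  qed (use that in \<open>simp add: e_def\<close>)
  have "x $ i = 0 \<longleftrightarrow> x' $ i = 0" "s $ i = 0 \<longleftrightarrow> s' $ i = 0" for i
    using path_cluster_cross(2,3)[OF c] path_cluster_cross(2,3)[OF c(2,1)] by blast+
  then have ex: "0 \<le> e (x $ i) (x' $ i) \<and> (e (x $ i) (x' $ i) = 0 \<longrightarrow> x $ i = x' $ i)"
    and es: "0 \<le> e (s $ i) (s' $ i) \<and> (e (s $ i) (s' $ i) = 0 \<longrightarrow> s $ i = s' $ i)" for i
    using path_cluster_optimal(3,4)[OF c(1)] path_cluster_optimal(3,4)[OF c(2)]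
    by (intro e; blast)+
  \<comment> \<open>The sum is n + n - 2n; the last term is the cross identity of (x, s) with
    itself, which counts the nonzero coordinates.\<close>
  have "(\<Sum>i\<in>UNIV. e (x $ i) (x' $ i) + e (s $ i) (s' $ i)) = 0"
    using path_cluster_cross(1)[OF c] path_cluster_cross(1)[OF c(2,1)]
      path_cluster_cross(1)[OF c(1,1)]
    by (simp only: e_def sum.distrib sum_subtractf sum_distrib_left[symmetric])
  then have "\<forall>i\<in>UNIV. e (x $ i) (x' $ i) + e (s $ i) (s' $ i) = 0"
    using ex es by (subst (asm) sum_nonneg_eq_0_iff) (auto intro!: add_nonneg_nonneg)
  then have z: "e (x $ i) (x' $ i) + e (s $ i) (s' $ i) = 0" for i by blast
  have "e (x $ i) (x' $ i) = 0" "e (s $ i) (s' $ i) = 0" for i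
    using ex[of i] es[of i] z[of i] by linarith+
  then show ?thesis using ex es by (simp add: vec_eq_iff)
qed

lemma path_convergent_subsequence:
  assumes "\<And>k :: nat. 0 < \<nu> k \<and> \<nu> k \<le> 1" "\<nu> \<longlonglongrightarrow> 0"
    and "\<And>k. central_pair W W' p q (\<nu> k) (fst (Z k)) (snd (Z k))"
  shows "\<exists>r L. strict_mono r \<and> (Z \<circ> r) \<longlonglongrightarrow> L \<and> path_cluster (fst L) (snd L)"
proof -
  interpret dual: primal_dual_pair W' W q p by (rule dual_pair)
  \<comment> \<open>As \<nu> \<le> 1, the two objectives sum to at most M; both are nonnegative, so
    each is at most M.\<close>
  define M where "M = p \<bullet> q + real CARD('n)"
  define K where
    "K = {x \<in> nonneg_slice W p. q \<bullet> x \<le> M} \<times> {s \<in> nonneg_slice W' q. p \<bullet> s \<le> M}"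
  have ZK: "\<forall>k. Z k \<in> K"
  proof
    fix k
    note in_slices = central_pair_nonneg_slice[OF assms(3), of k]
    have "real CARD('n) * \<nu> k \<le> real CARD('n)" using assms(1)[of k] by simp
    then have "q \<bullet> fst (Z k) + p \<bullet> snd (Z k) \<le> M"
      using central_pair_gap[OF assms(3), of k] by (simp add: M_def)
    then show "Z k \<in> K"
      using in_slices inner_nonneg[of "fst (Z k)"] dual.inner_nonneg[of "snd (Z k)"]
      by (simp add: K_def mem_Times_iff)
  qed
  have "compact K" unfolding K_def by (intro compact_Times compact_sublevel dual.compact_sublevel)
  then obtain L r where L: "strict_mono r" "(Z \<circ> r) \<longlonglongrightarrow> L"
    using ZK compact_def[of K] by metis
  have "path_cluster (fst L) (snd L)"
    unfolding path_cluster_def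
  proof (intro exI conjI allI)
    show "(\<nu> \<circ> r) \<longlonglongrightarrow> 0" using assms(2) L(1) by (rule LIMSEQ_subseq_LIMSEQ)
    show "(\<lambda>k. fst ((Z \<circ> r) k)) \<longlonglongrightarrow> fst L" "(\<lambda>k. snd ((Z \<circ> r) k)) \<longlonglongrightarrow> snd L"
      using tendsto_fst[OF L(2)] tendsto_snd[OF L(2)] by (simp_all add: o_def)
  qed (use assms in auto)
  then show ?thesis using L by blast
qed

text \<open>Compactness along 1 / (k + 1) yields a cluster point L; a sequence that does not tend to
  L would have a second cluster point.\<close>

lemma central_path_tendsto:
  assumes Z: "\<And>\<mu>. 0 < \<mu> \<Longrightarrow> central_pair W W' p q \<mu> (fst (Z \<mu>)) (snd (Z \<mu>))"
  shows "\<exists>L. (Z \<longlongrightarrow> L) (at_right 0)"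
proof -
  define \<nu>0 :: "nat \<Rightarrow> real" where "\<nu>0 k = 1 / real (Suc k)" for k
  have "\<nu>0 \<longlonglongrightarrow> 0" unfolding \<nu>0_def using LIMSEQ_inverse_real_of_nat by (simp add: inverse_eq_divide)
  then obtain r0 L where L: "path_cluster (fst L) (snd L)"
    using path_convergent_subsequence[of \<nu>0 "Z \<circ> \<nu>0"] Z by (auto simp: \<nu>0_def)
  have "(Z \<longlongrightarrow> L) (at_right 0)"
  proof (rule tendsto_at_right_sequentially[of _ 1])
    fix \<nu> :: "nat \<Rightarrow> real"
    assume \<nu>: "\<And>k. 0 < \<nu> k" "\<And>k. \<nu> k < 1" "\<nu> \<longlonglongrightarrow> 0"
    show "(\<lambda>k. Z (\<nu> k)) \<longlonglongrightarrow> L"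
    proof (rule ccontr)
      assume "\<not> ?thesis"
      then obtain e where e: "0 < e" "\<exists>\<^sub>F k in sequentially. e \<le> dist (Z (\<nu> k)) L"
        unfolding tendsto_iff by (auto simp: not_eventually not_less)
      then have "infinite {k. e \<le> dist (Z (\<nu> k)) L}"
        by (simp add: cofinite_eq_sequentially[symmetric] frequently_cofinite)
      then obtain r :: "nat \<Rightarrow> nat" where r: "strict_mono r" "\<And>k. e \<le> dist (Z (\<nu> (r k))) L"
        using infinite_enumerate by blast
      have lim: "(\<nu> \<circ> r) \<longlonglongrightarrow> 0" using \<nu>(3) r(1) by (rule LIMSEQ_subseq_LIMSEQ)
      then obtain r' L' where L': "(Z \<circ> (\<nu> \<circ> r) \<circ> r') \<longlonglongrightarrow> L'" "path_cluster (fst L') (snd L')"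
        using path_convergent_subsequence[of "\<nu> \<circ> r" "Z \<circ> (\<nu> \<circ> r)"] \<nu> Z
        by (auto simp: less_imp_le)
      have "L' = L" using path_cluster_unique[OF L'(2) L] by (simp add: prod_eq_iff)
      then have "\<forall>\<^sub>F k in sequentially. dist ((Z \<circ> (\<nu> \<circ> r) \<circ> r') k) L < e"
        using L'(1) e(1) by (auto simp: tendsto_iff)
      then obtain k where "dist (Z (\<nu> (r (r' k)))) L < e"
        by (auto simp: eventually_sequentially)
      then show False using r(2)[of "r' k"] by simp
    qed
  qed simp
  then show ?thesis by blast
qed

end

section \<open>The linear program\<close>

lemma inner_vector_matrix_mult: "x \<bullet> (y v* A) = (A *v x) \<bullet> y" for A :: "real^'n^'m"
  by (metis dot_lmul_matrix inner_commute)

text \<open>Fixing strictly feasible points changes the objectives only by constants: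
  \<open>c \<bullet> x\<close> is \<open>q \<bullet> x\<close> plus a constant, and
  \<open>b \<bullet> y\<close> is a constant minus \<open>p \<bullet> s\<close>. Suboptimality is
  thus preserved.\<close>

locale linear_program =
  fixes A :: "real^'n^'m" and b :: "real^'m" and c :: "real^'n"
    and p q :: "real^'n" and y0 :: "real^'m"
  assumes Ap: "A *v p = b" and p_pos: "0 < p $ i"
    and y0q: "transpose A *v y0 + q = c" and q_pos: "0 < q $ i"
begin

definition "W = {x. A *v x = 0}"
definition "W' = range ((*v) (transpose A))"

sublocale primal_dual_pair W W' p q
proof
  show "subspace W"
    by (auto simp: W_def subspace_def matrix_vector_right_distrib matrix_vector_mult_scaleR)
  show sub': "subspace W'"
    unfolding W'_def by (rule linear_subspace_image) (auto intro: matrix_vector_mul_linear)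
  show "x \<bullet> y = 0" if "x \<in> W" "y \<in> W'" for x y
    using that by (auto simp: W_def W'_def inner_vector_matrix_mult)
  show "\<exists>x\<in>W. \<exists>y\<in>W'. z = x + y" for z
  proof -
    obtain y x where xy: "y \<in> span W'" "\<And>w. w \<in> span W' \<Longrightarrow> orthogonal x w" "z = y + x"
      using orthogonal_subspace_decomp_exists[where S = W' and x = z] by metis
    \<comment> \<open>x is orthogonal to the range of the transpose, in particular to the image of
      \<open>A *v x\<close>.\<close>
    have "(A *v x) \<bullet> (A *v x) = 0"
      using xy(2)[of "transpose A *v (A *v x)"]
      by (auto simp: W'_def orthogonal_def inner_vector_matrix_mult intro: span_base)
    then have "x \<in> W" by (simp add: W_def)
    moreover have "y \<in> W'" using xy(1) sub' by (simp add: span_eq_iff[THEN iffD2])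
    ultimately show ?thesis using xy(3) by (metis add.commute)
  qed
qed (use p_pos q_pos in auto)

lemma primal_feasible_eq: "primal_feasible A b = nonneg_slice W p"
  by (auto simp: primal_feasible_def nonneg_slice_def W_def matrix_vector_mult_diff_distrib Ap)

lemma c_inner: "x \<in> nonneg_slice W p \<Longrightarrow> c \<bullet> x = y0 \<bullet> b + q \<bullet> x"
proof -
  assume "x \<in> nonneg_slice W p"
  then have "A *v x = b" by (auto simp: primal_feasible_eq[symmetric] primal_feasible_def)
  then have "x \<bullet> (transpose A *v y0) = b \<bullet> y0" by (simp add: inner_vector_matrix_mult)
  then show ?thesis unfolding y0q[symmetric] by (simp add: inner_add_left inner_add_right inner_commute)
qed

lemma opt_value_eq: "opt_value A b c = y0 \<bullet> b + slice_min W p q"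
proof -
  obtain x where x: "x \<in> nonneg_slice W p" "q \<bullet> x = slice_min W p q"
    using slice_min_attained by blast
  show ?thesis
    unfolding opt_value_def primal_feasible_eq
  proof (rule cInf_eq_minimum)
    show "y0 \<bullet> b + slice_min W p q \<in> (\<bullet>) c ` nonneg_slice W p"
      using x c_inner by (metis image_eqI)
  qed (use c_inner slice_min_le in fastforce)
qed

lemma x_max_eq: "x_max A b c i = coord_max W p q i"
proof
  fix g
  have "x \<in> nonneg_slice W p \<and> c \<bullet> x \<le> opt_value A b c + g \<longleftrightarrow>
      x \<in> nonneg_slice W p \<and> q \<bullet> x \<le> slice_min W p q + g" for x
    using c_inner[of x] by (auto simp: opt_value_eq)
  then show "x_max A b c i g = coord_max W p q i g"
    unfolding x_max_def coord_max_def primal_feasible_eq by simp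
qed

lemma dual_affine_iff: "(\<exists>y. transpose A *v y + s = c) \<longleftrightarrow> s - q \<in> W'"
proof
  assume "\<exists>y. transpose A *v y + s = c"
  then obtain y where y: "transpose A *v y + s = c" ..
  have "s - q = transpose A *v (y0 - y)"
    using y y0q by (simp add: matrix_vector_mult_diff_distrib algebra_simps)
  then show "s - q \<in> W'" by (simp add: W'_def)
next
  assume "s - q \<in> W'"
  then obtain w where "s - q = transpose A *v w" by (auto simp: W'_def)
  then have "transpose A *v (y0 - w) + s = c"
    using y0q by (simp add: matrix_vector_mult_diff_distrib algebra_simps)
  then show "\<exists>y. transpose A *v y + s = c" ..
qed

lemma b_inner:
  assumes "transpose A *v y + s = c"
  shows "b \<bullet> y = y0 \<bullet> b + p \<bullet> q - p \<bullet> s"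
proof -
  have "p \<bullet> (transpose A *v y + s) = p \<bullet> (transpose A *v y0 + q)" using assms y0q by simp
  then show ?thesis by (simp add: inner_add_right inner_vector_matrix_mult Ap inner_commute)
qed

text \<open>\<open>opt_value\<close> is the primal value, so strong duality is needed to read the
  dual level sets as sublevel sets of \<open>p \<bullet> s\<close>.\<close>

lemma s_max_eq: "s_max A b c i = coord_max W' q p i"
proof
  fix g
  have "(\<exists>y. (y, s) \<in> dual_feasible A c \<and> opt_value A b c - g \<le> b \<bullet> y) \<longleftrightarrow>
      s \<in> nonneg_slice W' q \<and> p \<bullet> s \<le> slice_min W' q p + g" for s
  proof -
    have "opt_value A b c - g \<le> b \<bullet> y \<longleftrightarrow> p \<bullet> s \<le> slice_min W' q p + g"
      if "transpose A *v y + s = c" for y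
      using b_inner[OF that] strong_duality unfolding opt_value_eq by linarith
    then show ?thesis
      unfolding dual_feasible_def nonneg_slice_def dual_affine_iff[symmetric] by auto
  qed
  then have "{s $ i | y s. (y, s) \<in> dual_feasible A c \<and> b \<bullet> y \<ge> opt_value A b c - g} =
      {s $ i | s. s \<in> nonneg_slice W' q \<and> p \<bullet> s \<le> slice_min W' q p + g}"
    by blast
  then show "s_max A b c i g = coord_max W' q p i g"
    unfolding s_max_def coord_max_def by simp
qed

section \<open>The central path of the program\<close>

lemma is_central_point_iff: "is_central_point A b c \<mu> (x, s) \<longleftrightarrow> central_pair W W' p q \<mu> x s"
proof -
  have "A *v x = b \<longleftrightarrow> x - p \<in> W" by (simp add: W_def matrix_vector_mult_diff_distrib Ap)
  then show ?thesis unfolding is_central_point_def central_pair_def dual_affine_iff by auto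
qed

lemma central_path_central_pair:
  assumes "0 < \<mu>"
  shows "central_pair W W' p q \<mu> (x_cp A b c \<mu>) (s_cp A b c \<mu>)"
proof -
  have "\<exists>!z. is_central_point A b c \<mu> z"
  proof (rule ex_ex1I)
    show "\<exists>z. is_central_point A b c \<mu> z"
      using central_pair_exists[OF assms] is_central_point_iff by blast
    show "z = z'" if "is_central_point A b c \<mu> z" "is_central_point A b c \<mu> z'" for z z'
      using that central_pair_unique[OF assms] by (cases z; cases z') (auto simp: is_central_point_iff)
  qed
  from theI'[OF this] have "is_central_point A b c \<mu> (central_path A b c \<mu>)"
    using assms by (simp add: central_path_def)
  then show ?thesis using is_central_point_iff by (metis prod.collapse)
qed

text \<open>The value at 0 is a \<open>Lim\<close>, which is the actual limit only once convergence
  is known.\<close>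

lemma central_path_tendsto_0: "(central_path A b c \<longlongrightarrow> central_path A b c 0) (at_right 0)"
proof -
  obtain L where L: "(central_path A b c \<longlongrightarrow> L) (at_right 0)"
    using central_path_tendsto central_path_central_pair by blast
  have ev: "\<forall>\<^sub>F \<mu> in at_right 0. central_path A b c \<mu> = (THE z. is_central_point A b c \<mu> z)"
    unfolding eventually_at_right_field by (intro exI[of _ 1]) (auto simp: central_path_def)
  have "((\<lambda>\<mu>. THE z. is_central_point A b c \<mu> z) \<longlongrightarrow> L) (at_right 0)"
    by (rule tendsto_cong[OF ev, THEN iffD1, OF L])
  then have "central_path A b c 0 = L"
    unfolding central_path_def by (simp add: tendsto_Lim)
  then show ?thesis using L by simp
qed

lemma reciprocal_pairs:
  assumes "\<theta> < 1"
  shows "reciprocal_pair (\<lambda>\<mu>. x_cp A b c \<mu> $ i) (\<lambda>\<mu>. s_cp A b c \<mu> $ i) (x_max A b c i) (real CARD('n)) \<theta>"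
    and "reciprocal_pair (\<lambda>\<mu>. s_cp A b c \<mu> $ i) (\<lambda>\<mu>. x_cp A b c \<mu> $ i) (s_max A b c i) (real CARD('n)) \<theta>"
proof -
  interpret dual: primal_dual_pair W' W q p by (rule dual_pair)
  have c: "central_pair W W' p q \<mu> (x_cp A b c \<mu>) (s_cp A b c \<mu>)"
    and c': "central_pair W' W q p \<mu> (s_cp A b c \<mu>) (x_cp A b c \<mu>)" if "0 < \<mu>" for \<mu>
    using central_path_central_pair[OF that] by (auto simp: central_pair_def mult.commute)
  show "reciprocal_pair (\<lambda>\<mu>. x_cp A b c \<mu> $ i) (\<lambda>\<mu>. s_cp A b c \<mu> $ i) (x_max A b c i) (real CARD('n)) \<theta>"
    unfolding x_max_eq
  proof
    fix \<mu> :: real assume \<mu>: "0 < \<mu>"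
    show "0 < x_cp A b c \<mu> $ i" "x_cp A b c \<mu> $ i * s_cp A b c \<mu> $ i = \<mu>"
      using c[OF \<mu>] by (auto simp: central_pair_def)
    show "x_cp A b c \<mu> $ i \<le> coord_max W p q i (real CARD('n) * \<mu>)"
      by (rule central_pair_le_coord_max[OF \<mu> c[OF \<mu>]])
    show "coord_max W p q i (real CARD('n) * \<mu>) \<le> 2 * real CARD('n) * x_cp A b c \<mu> $ i"
      by (rule coord_max_le_central_pair[OF \<mu> c[OF \<mu>]])
  qed (use assms in auto)
  show "reciprocal_pair (\<lambda>\<mu>. s_cp A b c \<mu> $ i) (\<lambda>\<mu>. x_cp A b c \<mu> $ i) (s_max A b c i) (real CARD('n)) \<theta>"
    unfolding s_max_eq
  proof
    fix \<mu> :: real assume \<mu>: "0 < \<mu>"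
    show "0 < s_cp A b c \<mu> $ i" "s_cp A b c \<mu> $ i * x_cp A b c \<mu> $ i = \<mu>"
      using c'[OF \<mu>] by (auto simp: central_pair_def)
    show "s_cp A b c \<mu> $ i \<le> coord_max W' q p i (real CARD('n) * \<mu>)"
      by (rule dual.central_pair_le_coord_max[OF \<mu> c'[OF \<mu>]])
    show "coord_max W' q p i (real CARD('n) * \<mu>) \<le> 2 * real CARD('n) * s_cp A b c \<mu> $ i"
      by (rule dual.coord_max_le_central_pair[OF \<mu> c'[OF \<mu>]])
  qed (use assms in auto)
qed

text \<open>\<open>K\<close> stays abstract because the primal and dual complexities enter only as
  bounds on the number of breakpoints.\<close>

lemma polarized_decomposition:
  assumes \<theta>: "0 \<le> \<theta>" "\<theta> < 1" and \<mu>: "0 \<le> \<mu>1" "\<mu>1 < \<mu>0"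
    and breakpoints: "\<And>i. \<exists>D. finite D \<and> D \<subseteq> {\<mu>1<..<\<mu>0} \<and> card D + 1 \<le> K i \<and>
      (\<forall>a a'. \<mu>1 \<le> a \<longrightarrow> a < a' \<longrightarrow> a' \<le> \<mu>0 \<longrightarrow> D \<inter> {a<..<a'} = {} \<longrightarrow>
        almost_decreasing ((1 - \<theta>) / (4 * real CARD('n))) (\<lambda>\<mu>. x_cp A b c \<mu> $ i) a a' \<or>
        almost_decreasing ((1 - \<theta>) / (4 * real CARD('n))) (\<lambda>\<mu>. s_cp A b c \<mu> $ i) a a')"
  shows "\<exists>(T :: nat) h (B :: nat \<Rightarrow> 'n set) N. h 0 = \<mu>0 \<and> h T = \<mu>1 \<and>
    (\<forall>k\<in>{1..T}. h k < h (k - 1)) \<and>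
    (\<forall>k\<in>{1..T}. polarized A b c ((1 - \<theta>) / (4 * real CARD('n))) (h k) (h (k - 1)) (B k) (N k)) \<and>
    N 0 = {} \<and> max (\<Sum>k=1..T. card (sym_diff (N k) (N (k - 1)))) T \<le> (\<Sum>i\<in>UNIV. K i)"
proof -
  define \<gamma> where "\<gamma> = (1 - \<theta>) / (4 * real CARD('n))"
  have "1 \<le> real CARD('n)" by (simp add: Suc_le_eq)
  then have "1 - \<theta> \<le> 4 * real CARD('n)" using \<theta> by linarith
  then have \<gamma>: "0 < \<gamma>" "\<gamma> \<le> 1" using \<theta> by (auto simp: \<gamma>_def divide_le_eq)
  define P where "P i = almost_decreasing \<gamma> (\<lambda>\<mu>. x_cp A b c \<mu> $ i)" for i
  define Q where "Q i = almost_decreasing \<gamma> (\<lambda>\<mu>. s_cp A b c \<mu> $ i)" for i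
  have "\<forall>i. \<exists>D. finite D \<and> D \<subseteq> {\<mu>1<..<\<mu>0} \<and> card D + 1 \<le> K i \<and>
      (\<forall>a a'. \<mu>1 \<le> a \<longrightarrow> a < a' \<longrightarrow> a' \<le> \<mu>0 \<longrightarrow> D \<inter> {a<..<a'} = {} \<longrightarrow> P i a a' \<or> Q i a a')"
    using breakpoints unfolding P_def Q_def \<gamma>_def by blast
  from choice[OF this] obtain D where "\<forall>i. finite (D i) \<and> D i \<subseteq> {\<mu>1<..<\<mu>0} \<and> card (D i) + 1 \<le> K i \<and>
      (\<forall>a a'. \<mu>1 \<le> a \<longrightarrow> a < a' \<longrightarrow> a' \<le> \<mu>0 \<longrightarrow> D i \<inter> {a<..<a'} = {} \<longrightarrow> P i a a' \<or> Q i a a')" ..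
  then have D: "\<And>i. finite (D i)" "\<And>i. D i \<subseteq> {\<mu>1<..<\<mu>0}" "\<And>i. card (D i) + 1 \<le> K i"
    "\<And>i a a'. \<mu>1 \<le> a \<Longrightarrow> a < a' \<Longrightarrow> a' \<le> \<mu>0 \<Longrightarrow> D i \<inter> {a<..<a'} = {} \<Longrightarrow> P i a a' \<or> Q i a a'"
    by blast+
  have mono: "P i a a' \<Longrightarrow> a \<le> d \<Longrightarrow> d' \<le> a' \<Longrightarrow> P i d d'"
    "Q i a a' \<Longrightarrow> a \<le> d \<Longrightarrow> d' \<le> a' \<Longrightarrow> Q i d d'" for i a a' d d'
    unfolding P_def Q_def by (rule almost_decreasing_mono; assumption)+
  show ?thesis
  proof (rule merge_labelled_partitions[OF \<mu>(2) D mono])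
    fix T :: nat and h N
    assume h: "h 0 = \<mu>0" "h T = \<mu>1" "\<And>k. k \<in> {1..T} \<Longrightarrow> h k < h (k - 1)"
      and PQ: "\<And>k i. k \<in> {1..T} \<Longrightarrow> i \<notin> N k \<Longrightarrow> P i (h k) (h (k - 1))"
        "\<And>k i. k \<in> {1..T} \<Longrightarrow> i \<in> N k \<Longrightarrow> Q i (h k) (h (k - 1))"
      and N: "N 0 = {}" "max (\<Sum>k=1..T. card (sym_diff (N k) (N (k - 1)))) T \<le> (\<Sum>i\<in>UNIV. K i)"
    have lower: "\<mu>1 \<le> h (T - j)" for j
    proof (induction j)
      case (Suc j)
      have "h (T - j) < h (T - j - 1)" if "j < T" using h(3)[of "T - j"] that by auto
      then show ?case using Suc by (cases "j < T") auto
    qed (simp add: h)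
    have "polarized A b c \<gamma> (h k) (h (k - 1)) (- N k) (N k)" if k: "k \<in> {1..T}" for k
    proof -
      have hk: "0 \<le> h k" "h k < h (k - 1)" using lower[of "T - k"] k h(3)[OF k] \<mu> by auto
      have X: "((\<lambda>\<mu>. x_cp A b c \<mu> $ i) \<longlongrightarrow> x_cp A b c 0 $ i) (at_right 0)"
        "((\<lambda>\<mu>. s_cp A b c \<mu> $ i) \<longlongrightarrow> s_cp A b c 0 $ i) (at_right 0)" for i
        by (intro tendsto_vec_nth tendsto_fst tendsto_snd central_path_tendsto_0)+
      show ?thesis
        unfolding polarized_def
        using \<gamma> hk almost_decreasing_right_end[OF X(1) PQ(1)[OF k, unfolded P_def] hk]
          almost_decreasing_right_end[OF X(2) PQ(2)[OF k, unfolded Q_def] hk] by auto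
    qed
    then show ?thesis
      using h N unfolding \<gamma>_def[symmetric]
      by (intro exI[of _ T] exI[of _ h] exI[of _ "\<lambda>k. - N k"] exI[of _ N]) auto
  qed
qed

end

theorem theorem1p8:
  fixes A :: "real^'n^'m" and b :: "real^'m" and c :: "real^'n"
    and \<theta> \<mu>0 \<mu>1 :: real
  assumes "CARD('m) \<le> CARD('n)"
    and "rank A = CARD('m)"
    and "primal_strictly_feasible A b"
    and "dual_strictly_feasible A c"
    and "0 \<le> \<theta>" and "\<theta> < 1"
    and "0 \<le> \<mu>1" and "\<mu>1 < \<mu>0"
  shows "\<exists>(T :: nat) (h :: nat \<Rightarrow> real) (B :: nat \<Rightarrow> 'n set) (N :: nat \<Rightarrow> 'n set).
           h 0 = \<mu>0 \<and> h T = \<mu>1 \<and>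
           (\<forall>k\<in>{1..T}. h k < h (k - 1)) \<and>
           (\<forall>k\<in>{1..T}.
              polarized A b c ((1 - \<theta>) / (4 * real CARD('n))) (h k) (h (k - 1)) (B k) (N k)) \<and>
           N 0 = {} \<and>
           max (\<Sum>k=1..T. card (sym_diff (N k) (N (k - 1)))) T
             \<le> 2 * min (\<Sum>i\<in>UNIV. SLC_primal A b c i \<theta> (real CARD('n) * \<mu>1) (real CARD('n) * \<mu>0))
                       (\<Sum>i\<in>UNIV. SLC_dual A b c i \<theta> (real CARD('n) * \<mu>1) (real CARD('n) * \<mu>0))"
proof -
  obtain p where p: "A *v p = b" "\<And>i. 0 < p $ i"
    using assms(3) unfolding primal_strictly_feasible_def by blast
  obtain y0 q where q: "transpose A *v y0 + q = c" "\<And>i. 0 < q $ i"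
    using assms(4) unfolding dual_strictly_feasible_def by blast
  interpret linear_program A b c p q y0 by unfold_locales (use p q in auto)
  interpret dual: primal_dual_pair W' W q p by (rule dual_pair)
  have range: "0 \<le> real CARD('n) * \<mu>1" "real CARD('n) * \<mu>1 < real CARD('n) * \<mu>0"
    using assms by simp_all
  note decomposition = polarized_decomposition[OF assms(5-8)]
  \<comment> \<open>No decomposition has to serve both sums: the smaller one chooses which
    subdivision is used.\<close>
  show ?thesis
  proof (cases "(\<Sum>i\<in>UNIV. SLC_primal A b c i \<theta> (real CARD('n) * \<mu>1) (real CARD('n) * \<mu>0))
      \<le> (\<Sum>i\<in>UNIV. SLC_dual A b c i \<theta> (real CARD('n) * \<mu>1) (real CARD('n) * \<mu>0))")
    case True
    show ?thesis
      unfolding min_absorb1[OF True]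
      unfolding sum_distrib_left SLC_primal_def
      by (rule decomposition, rule reciprocal_pair.slc_breakpoints[OF reciprocal_pairs(1)[OF assms(6)]])
        (unfold x_max_eq, rule coord_max_polygon[OF range assms(5)])
  next
    case False
    then have *: "(\<Sum>i\<in>UNIV. SLC_dual A b c i \<theta> (real CARD('n) * \<mu>1) (real CARD('n) * \<mu>0))
      \<le> (\<Sum>i\<in>UNIV. SLC_primal A b c i \<theta> (real CARD('n) * \<mu>1) (real CARD('n) * \<mu>0))" by simp
    show ?thesis
      unfolding min_absorb2[OF *]
      unfolding sum_distrib_left SLC_dual_def
    proof (rule decomposition)
      fix i
      show "\<exists>D. finite D \<and> D \<subseteq> {\<mu>1<..<\<mu>0} \<and>
          card D + 1 \<le> 2 * slc (s_max A b c i) \<theta> (real CARD('n) * \<mu>1) (real CARD('n) * \<mu>0) \<and>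
          (\<forall>a a'. \<mu>1 \<le> a \<longrightarrow> a < a' \<longrightarrow> a' \<le> \<mu>0 \<longrightarrow> D \<inter> {a<..<a'} = {} \<longrightarrow>
            almost_decreasing ((1 - \<theta>) / (4 * real CARD('n))) (\<lambda>\<mu>. x_cp A b c \<mu> $ i) a a' \<or>
            almost_decreasing ((1 - \<theta>) / (4 * real CARD('n))) (\<lambda>\<mu>. s_cp A b c \<mu> $ i) a a')"
        \<comment> \<open>The swapped pair yields the alternatives in the order s, x; they are
          exchanged so that N still refers to s.\<close>
        unfolding disj_commute[of "almost_decreasing _ (\<lambda>\<mu>. x_cp A b c \<mu> $ i) _ _"]
        by (rule reciprocal_pair.slc_breakpoints[OF reciprocal_pairs(2)[OF assms(6)]])
          (unfold s_max_eq, rule dual.coord_max_polygon[OF range assms(5)])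
    qed
  qed
qed

end
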